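(* There exist positive constants $C_0$ and $c$ such that the following holds for every sufficiently large integer $n$. Let $k$ be an integer with $0\leq k\leq \frac{n-1}{2}$, let $\varepsilon\in(-\frac12,\frac12]$ and $\delta\geq 0$ be such that $\max\{|\varepsilon|,\delta\}\leq ck$. If $\mathcal{F}\subseteq S_n$ has size $|\mathcal{F}|=(k+\varepsilon)(n-1)!$ and $\mathcal{I}(\mathcal{F})\geq \mathcal{I}(\mathcal{T}(n,|\mathcal{F}|))-\delta((n-1)!)^2$, then there exists some $\mathcal{G}\subseteq S_n$ that is a union of $k$ $1$-cosets such that $$|\mathcal{F}\Delta\mathcal{G}|\leq C_0\left(\sqrt{2k(|\varepsilon|+\delta)}+\frac{k}{n}\right)|\mathcal{F}|.$$ Moreover, when $\varepsilon=\delta=0$, $\mathcal{F}=\mathcal{G}_0$ for some $\mathcal{G}_0\subseteq S_n$ that is a union of $k$ pairwise disjoint $1$-cosets.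
   Context: $S_n$ is the symmetric group of all permutations of $[n]=\{1,\ldots,n\}$. A $1$-coset is a set of the form $\mathcal{C}_{i\to j}=\{\sigma\in S_n:\sigma(i)=j\}$ with $i,j\in[n]$. For $\mathcal{F}\subseteq S_n$, the total intersection number is $\mathcal{I}(\mathcal{F})=\sum_{A\in\mathcal{F}}\sum_{B\in\mathcal{F}}|\{i\in[n]:A(i)=B(i)\}|$ (sum over ordered pairs, including $A=B$). For an integer $s>\frac12(n-1)!$ (with $s\le n!$), consider the subfamilies of $S_n$ of size $s$ consisting of $\lfloor\frac{s}{(n-1)!}\rfloor$ pairwise disjoint $1$-cosets together with $s-\lfloor\frac{s}{(n-1)!}\rfloor(n-1)!$ permutations from another $1$-coset disjoint from all the former $1$-cosets; $\mathcal{T}(n,s)$ denotes a family of this form with maximal total intersection number among all families of this form of size $s$. For $s=0$, $\mathcal{T}(n,0)$ is the empty family. $\Delta$ denotes symmetric difference. *)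

theory Defs
  imports Complex_Main "HOL-Combinatorics.Permutations"
begin

definition Sym :: "nat \<Rightarrow> (nat \<Rightarrow> nat) set" where
  "Sym n = {\<sigma>. \<sigma> permutes {1..n}}"

definition one_coset :: "nat \<Rightarrow> nat \<Rightarrow> nat \<Rightarrow> (nat \<Rightarrow> nat) set" where
  "one_coset n i j = {\<sigma> \<in> Sym n. \<sigma> i = j}"

definition one_cosets :: "nat \<Rightarrow> (nat \<Rightarrow> nat) set set" where
  "one_cosets n = {one_coset n i j |i j. i \<in> {1..n} \<and> j \<in> {1..n}}"

definition total_intersection :: "nat \<Rightarrow> (nat \<Rightarrow> nat) set \<Rightarrow> nat" where
  "total_intersection n F = (\<Sum>A\<in>F. \<Sum>B\<in>F. card {i \<in> {1..n}. A i = B i})"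

text \<open>
  If \<open>s\<close> is a multiple of \<open>(n-1)!\<close>, the leftover part \<open>R\<close> is empty and no further coset
  is required; for \<open>s = n!\<close> there is no coset disjoint from the \<open>n\<close> chosen ones.
\<close>
definition coset_form :: "nat \<Rightarrow> nat \<Rightarrow> (nat \<Rightarrow> nat) set \<Rightarrow> bool" where
  "coset_form n s F \<longleftrightarrow>
     (\<exists>P R. P \<subseteq> one_cosets n \<and> card P = s div fact (n - 1) \<and> pairwise disjnt P \<and>
        card R = s - (s div fact (n - 1)) * fact (n - 1) \<and>
        (R = {} \<or> (\<exists>D \<in> one_cosets n. (\<forall>C\<in>P. disjnt D C) \<and> R \<subseteq> D)) \<and>
        F = \<Union>P \<union> R)"

text \<open>
  For \<open>n \<ge> 1\<close> and \<open>s \<le> n!\<close> a family of this form exists and there are finitely many of them,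
  so a maximiser exists. It need not be unique, but its total intersection number does not
  depend on the choice. Only \<open>s = 0\<close> and \<open>s > (n-1)!/2\<close> are of interest.
\<close>
definition extremal_family :: "nat \<Rightarrow> nat \<Rightarrow> (nat \<Rightarrow> nat) set" where
  "extremal_family n s =
     (if s = 0 then {} else (ARG_MAX (total_intersection n) F. coset_form n s F))"

end

theory Submission
  imports Defs "HOL-Analysis.Convex"
begin

text \<open>
  Write \<open>x i j\<close> for the proportion of \<open>\<sigma> i = j\<close> covered by \<open>F\<close>, \<open>y\<close> for \<open>x\<close> minus its mean \<open>\<alpha>\<close>,
  and \<open>S\<close> for the sum of the squares of \<open>y\<close>. The total intersection number is \<open>S + \<kappa>\<^sup>2\<close> up to scaling,
  and it measures the projection \<open>h\<close> of the indicator \<open>f\<close> of \<open>F\<close> onto the functions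
  \<open>\<sigma> \<mapsto> (\<Sum>i. a i (\<sigma> i))\<close>: the hypothesis says that the squared distance from \<open>f\<close> to this space, suitably
  scaled, is at most \<open>\<bar>\<epsilon>\<bar> + \<delta>\<close>.

  When the distance is zero, \<open>f\<close> is a Boolean function of degree one. Two nonzero 2-by-2 minors
  \<open>a p q + a p' q' - a p q' - a p' q\<close> in disjoint rows and disjoint columns would make \<open>f\<close> take three values,
  and this forces all nonzero minors to use one common row or one common column, so that \<open>f \<sigma>\<close>
  depends only on one value of \<open>\<sigma>\<close> or of its inverse.

  In general, \<open>f\<^sup>2 = f\<close> bounds the sum of \<open>f h\<^sup>2\<close> from below, while expanding one factor \<open>h\<close> over the cosets
  shows that this sum is essentially the sum of \<open>y\<^sup>2 x\<close>. Hence the sum of \<open>y\<^sup>2 (1 - x)\<close> is small, and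
  the cosets with \<open>x i j \<ge> 3/4\<close> number about \<open>k\<close> and are almost filled by \<open>F\<close>.
\<close>

subsection \<open>Counting permutations with prescribed values\<close>

lemma permutation_extending:
  assumes "finite S" "A \<subseteq> S" "inj_on g A" "g ` A \<subseteq> S"
  shows "\<exists>\<tau>. \<tau> permutes S \<and> (\<forall>a\<in>A. \<tau> a = g a)"
proof -
  have fin: "finite A" using assms finite_subset by blast
  have "card (S - A) = card (S - g ` A)"
    using assms fin by (simp add: card_Diff_subset card_image)
  then obtain b where b: "bij_betw b (S - A) (S - g ` A)"
    using assms by (meson finite_Diff finite_same_card_bij)
  define \<tau> where "\<tau> = (\<lambda>x. if x \<in> A then g x else if x \<in> S then b x else x)"
  have "bij_betw \<tau> (A \<union> (S - A)) (g ` A \<union> (S - g ` A))"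
  proof (rule bij_betw_combine)
    show "bij_betw \<tau> A (g ` A)"
      using assms(3) by (intro bij_betw_imageI) (auto simp: \<tau>_def inj_on_def)
    show "bij_betw \<tau> (S - A) (S - g ` A)"
      using b by (rule iffD1[OF bij_betw_cong, rotated]) (auto simp: \<tau>_def)
  qed auto
  moreover have "A \<union> (S - A) = S" "g ` A \<union> (S - g ` A) = S" using assms by auto
  ultimately have "bij_betw \<tau> S S" by simp
  hence "\<tau> permutes S"
    by (rule bij_imp_permutes) (use assms in \<open>auto simp: \<tau>_def\<close>)
  thus ?thesis by (intro exI[of _ \<tau>]) (simp add: \<tau>_def)
qed

text \<open>Left composition with one fixed extension \<open>\<tau>\<close> turns the permutations
  of \<open>S - A\<close>, which fix \<open>A\<close> pointwise, into the permutations extending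
  \<open>g\<close>.\<close>

lemma card_permutations_extending:
  assumes "finite S" "A \<subseteq> S" "inj_on g A" "g ` A \<subseteq> S"
  shows "card {\<sigma>. \<sigma> permutes S \<and> (\<forall>a\<in>A. \<sigma> a = g a)} = fact (card S - card A)"
proof -
  obtain \<tau> where \<tau>: "\<tau> permutes S" "\<And>a. a \<in> A \<Longrightarrow> \<tau> a = g a"
    using permutation_extending[OF assms] by blast
  let ?X = "{\<sigma>. \<sigma> permutes S \<and> (\<forall>a\<in>A. \<sigma> a = g a)}"
  have "bij_betw (\<lambda>\<rho>. \<tau> \<circ> \<rho>) {\<rho>. \<rho> permutes S - A} ?X"
  proof (rule bij_betwI[where g = "\<lambda>\<sigma>. inv \<tau> \<circ> \<sigma>"])
    show "(\<lambda>\<rho>. \<tau> \<circ> \<rho>) \<in> {\<rho>. \<rho> permutes S - A} \<rightarrow> ?X"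
    proof safe
      fix \<rho> assume \<rho>: "\<rho> permutes S - A"
      show "\<tau> \<circ> \<rho> permutes S"
        using permutes_compose[OF permutes_subset[OF \<rho>] \<tau>(1)] by auto
      fix a assume "a \<in> A"
      thus "(\<tau> \<circ> \<rho>) a = g a" using \<tau>(2) \<rho> by (simp add: permutes_not_in)
    qed
    show "(\<lambda>\<sigma>. inv \<tau> \<circ> \<sigma>) \<in> ?X \<rightarrow> {\<rho>. \<rho> permutes S - A}"
    proof safe
      fix \<sigma> assume \<sigma>: "\<sigma> permutes S" "\<forall>a\<in>A. \<sigma> a = g a"
      have "inv \<tau> \<circ> \<sigma> permutes S"
        using permutes_compose[OF \<sigma>(1) permutes_inv[OF \<tau>(1)]] .
      moreover have "(inv \<tau> \<circ> \<sigma>) a = a" if "a \<in> A" for a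
        using that \<sigma> \<tau> by (metis comp_apply permutes_inverses(2))
      ultimately show "inv \<tau> \<circ> \<sigma> permutes S - A"
        by (rule permutes_superset) auto
    qed
  qed (simp_all add: fun_eq_iff permutes_inverses[OF \<tau>(1)])
  hence "card ?X = card {\<rho>. \<rho> permutes S - A}"
    by (simp add: bij_betw_same_card)
  also have "\<dots> = fact (card S - card A)"
    using assms by (subst card_permutations[OF _ ]) (auto simp: card_Diff_subset finite_subset)
  finally show ?thesis .
qed

lemma finite_Sym [simp]: "finite (Sym n)"
  unfolding Sym_def by (simp add: finite_permutations)

lemma card_Sym: "card (Sym n) = fact n"
  unfolding Sym_def by (simp add: card_permutations)

lemma Sym_in [simp]: "\<sigma> \<in> Sym n \<Longrightarrow> \<sigma> i \<in> {1..n} \<longleftrightarrow> i \<in> {1..n}"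
  unfolding Sym_def mem_Collect_eq by (rule permutes_in_image)

lemma Sym_inj: "\<sigma> \<in> Sym n \<Longrightarrow> \<sigma> i = \<sigma> j \<longleftrightarrow> i = j"
  unfolding Sym_def by (simp add: permutes_inj inj_eq)

lemma card_Sym_extending:
  assumes "A \<subseteq> {1..n}" "inj_on g A" "g ` A \<subseteq> {1..n}"
  shows "card {\<sigma>\<in>Sym n. \<forall>a\<in>A. \<sigma> a = g a} = fact (n - card A)"
  using card_permutations_extending[OF _ assms] by (simp add: Sym_def)

lemma card_one_coset:
  assumes "i \<in> {1..n}" "j \<in> {1..n}"
  shows "card {\<sigma>\<in>Sym n. \<sigma> i = j} = fact (n - 1)"
  using card_Sym_extending[of "{i}" n "\<lambda>_. j"] assms by simp

lemma card_two_cosets: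
  assumes "i \<in> {1..n}" "j \<in> {1..n}" "i' \<in> {1..n}" "j' \<in> {1..n}" "i \<noteq> i'" "j \<noteq> j'"
  shows "card {\<sigma>\<in>Sym n. \<sigma> i = j \<and> \<sigma> i' = j'} = fact (n - 2)"
proof -
  have "{\<sigma>\<in>Sym n. \<sigma> i = j \<and> \<sigma> i' = j'} = {\<sigma>\<in>Sym n. \<forall>a\<in>{i,i'}. \<sigma> a = (if a = i then j else j')}"
    using assms by auto
  also have "card \<dots> = fact (n - card {i,i'})"
    by (rule card_Sym_extending) (use assms in \<open>auto simp: inj_on_def\<close>)
  also have "card {i,i'} = 2" using assms by auto
  finally show ?thesis .
qed

lemma card_three_cosets:
  assumes "i \<in> {1..n}" "j \<in> {1..n}" "i' \<in> {1..n} - {i}" "j' \<in> {1..n} - {j}"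
    "i'' \<in> {1..n} - {i}" "j'' \<in> {1..n} - {j}" "i' \<noteq> i''" "j' \<noteq> j''"
  shows "card {\<sigma>\<in>Sym n. \<sigma> i = j \<and> \<sigma> i' = j' \<and> \<sigma> i'' = j''} = fact (n - 3)"
proof -
  have "{\<sigma>\<in>Sym n. \<sigma> i = j \<and> \<sigma> i' = j' \<and> \<sigma> i'' = j''}
    = {\<sigma>\<in>Sym n. \<forall>a\<in>{i,i',i''}. \<sigma> a = (if a = i then j else if a = i' then j' else j'')}"
    using assms by auto
  also have "card \<dots> = fact (n - card {i,i',i''})"
    by (rule card_Sym_extending) (use assms in \<open>auto simp: inj_on_def\<close>)
  also have "card {i,i',i''} = 3" using assms by auto
  finally show ?thesis .
qed

text \<open>Both \<open>Sym n\<close> and a single coset satisfy the hypotheses of the next two lemmas, the latter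
  with one row and one column deleted.\<close>

lemma sum_evaluation:
  fixes a :: "'i \<Rightarrow> 'j \<Rightarrow> real" and T :: "('i \<Rightarrow> 'j) set"
  assumes fin: "finite T" "finite A" "finite B"
    and maps: "\<And>\<sigma> i. \<sigma> \<in> T \<Longrightarrow> i \<in> A \<Longrightarrow> \<sigma> i \<in> B"
  shows "(\<Sum>\<sigma>\<in>T. w \<sigma> * (\<Sum>i\<in>A. a i (\<sigma> i))) = (\<Sum>i\<in>A. \<Sum>j\<in>B. a i j * (\<Sum>\<sigma>\<in>{\<sigma>\<in>T. \<sigma> i = j}. w \<sigma>))"
proof -
  have "(\<Sum>\<sigma>\<in>T. w \<sigma> * (\<Sum>i\<in>A. a i (\<sigma> i))) = (\<Sum>i\<in>A. \<Sum>\<sigma>\<in>T. w \<sigma> * a i (\<sigma> i))"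
    by (subst sum.swap) (simp add: sum_distrib_left)
  also have "\<dots> = (\<Sum>i\<in>A. \<Sum>j\<in>B. \<Sum>\<sigma>\<in>{\<sigma>\<in>T. \<sigma> i = j}. w \<sigma> * a i (\<sigma> i))"
  proof (rule sum.cong[OF refl])
    fix i assume "i \<in> A"
    show "(\<Sum>\<sigma>\<in>T. w \<sigma> * a i (\<sigma> i)) = (\<Sum>j\<in>B. \<Sum>\<sigma>\<in>{\<sigma>\<in>T. \<sigma> i = j}. w \<sigma> * a i (\<sigma> i))"
      by (rule sum.group[symmetric]) (use fin maps \<open>i \<in> A\<close> in auto)
  qed
  also have "\<dots> = (\<Sum>i\<in>A. \<Sum>j\<in>B. a i j * (\<Sum>\<sigma>\<in>{\<sigma>\<in>T. \<sigma> i = j}. w \<sigma>))"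
    unfolding sum_distrib_left by (intro sum.cong refl) auto
  finally show ?thesis .
qed

lemma sum_fibre_evaluation:
  fixes a :: "'i \<Rightarrow> 'j \<Rightarrow> real" and T :: "('i \<Rightarrow> 'j) set"
  assumes fin: "finite T" "finite A" "finite B"
    and maps: "\<And>\<sigma> i. \<sigma> \<in> T \<Longrightarrow> i \<in> A \<Longrightarrow> \<sigma> i \<in> B"
    and inj: "\<And>\<sigma>. \<sigma> \<in> T \<Longrightarrow> inj_on \<sigma> A"
    and N1: "\<And>i j. i \<in> A \<Longrightarrow> j \<in> B \<Longrightarrow> card {\<sigma>\<in>T. \<sigma> i = j} = N1"
    and N2: "\<And>i j i' j'. i \<in> A \<Longrightarrow> j \<in> B \<Longrightarrow> i' \<in> A \<Longrightarrow> j' \<in> B \<Longrightarrow> i \<noteq> i' \<Longrightarrow> j \<noteq> j' \<Longrightarrow>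
      card {\<sigma>\<in>T. \<sigma> i = j \<and> \<sigma> i' = j'} = N2"
    and ij: "i \<in> A" "j \<in> B"
  shows "(\<Sum>\<sigma>\<in>{\<sigma>\<in>T. \<sigma> i = j}. \<Sum>i\<in>A. a i (\<sigma> i)) = N1 * a i j +
    N2 * ((\<Sum>i\<in>A. \<Sum>j\<in>B. a i j) - (\<Sum>j\<in>B. a i j) - (\<Sum>i\<in>A. a i j) + a i j)"
proof -
  define r where "r i = (\<Sum>j\<in>B. a i j)" for i
  define c where "c j = (\<Sum>i\<in>A. a i j)" for j
  define s where "s = (\<Sum>i\<in>A. \<Sum>j\<in>B. a i j)"
  \<comment> \<open>Injectivity leaves three kinds of cells: the cell \<open>(i,j)\<close> itself,
    cells sharing exactly one of its coordinates, whose joint fibre is empty, and cells in general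
    position.\<close>
  have cnt: "real (card {\<sigma>\<in>T. \<sigma> i = j \<and> \<sigma> i' = j'}) =
      (if i' = i then (if j' = j then N1 else 0) else (if j' = j then 0 else N2))"
    if "i' \<in> A" "j' \<in> B" for i' j'
  proof -
    have "i' = i \<longleftrightarrow> j' = j" if "\<sigma> \<in> T" "\<sigma> i = j" "\<sigma> i' = j'" for \<sigma>
      using inj_on_eq_iff[OF inj[OF that(1)] ij(1) \<open>i' \<in> A\<close>] that by auto
    hence empty: "{\<sigma>\<in>T. \<sigma> i = j \<and> \<sigma> i' = j'} = {}" if "(i' = i) \<noteq> (j' = j)"
      using that by blast
    have "card {\<sigma>\<in>T. \<sigma> i = j \<and> \<sigma> i' = j'} = 0" if "(i' = i) \<noteq> (j' = j)"
      by (subst empty[OF that]) simp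
    moreover have "card {\<sigma>\<in>T. \<sigma> i = j \<and> \<sigma> i' = j'} = N1" if "i' = i" "j' = j"
      using N1[OF ij] that by simp
    ultimately show ?thesis using N2[OF ij that] by (cases "i' = i"; cases "j' = j") simp_all
  qed
  have "(\<Sum>\<sigma>\<in>{\<sigma>\<in>T. \<sigma> i = j}. \<Sum>i\<in>A. a i (\<sigma> i)) =
      (\<Sum>i'\<in>A. \<Sum>j'\<in>B. a i' j' * real (card {\<sigma>\<in>T. \<sigma> i = j \<and> \<sigma> i' = j'}))"
    using sum_evaluation[of "{\<sigma>\<in>T. \<sigma> i = j}" A B "\<lambda>_. 1" a] fin maps by (simp add: conj_assoc)
  also have "\<dots> = (\<Sum>i'\<in>A. \<Sum>j'\<in>B. a i' j' *
      (if i' = i then (if j' = j then N1 else 0) else (if j' = j then 0 else N2)))"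
    by (intro sum.cong refl) (simp add: cnt)
  \<comment> \<open>Inclusion-exclusion form of the cases: weight \<open>N2\<close> everywhere,
    minus row \<open>i\<close> and column \<open>j\<close>, plus the cell they share.\<close>
  also have "\<dots> = (\<Sum>i'\<in>A. \<Sum>j'\<in>B. N2 * a i' j' - (if i' = i then N2 * a i j' else 0)
     - (if j' = j then N2 * a i' j else 0) + (if i' = i then if j' = j then N1 * a i j + N2 * a i j else 0 else 0))"
    by (intro sum.cong refl) auto
  also have "\<dots> = (\<Sum>i'\<in>A. N2 * r i' - (if i' = i then N2 * r i else 0)
     - N2 * a i' j + (if i' = i then N1 * a i j + N2 * a i j else 0))"
  proof (intro sum.cong refl)
    fix i' assume "i' \<in> A"
    show "(\<Sum>j'\<in>B. N2 * a i' j' - (if i' = i then N2 * a i j' else 0)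
     - (if j' = j then N2 * a i' j else 0) + (if i' = i then if j' = j then N1 * a i j + N2 * a i j else 0 else 0))
     = N2 * r i' - (if i' = i then N2 * r i else 0)
     - N2 * a i' j + (if i' = i then N1 * a i j + N2 * a i j else 0)"
      using ij fin by (cases "i' = i") (simp_all add: sum.distrib sum_subtractf r_def sum_distrib_left)
  qed
  also have "\<dots> = N2 * s - N2 * r i - N2 * c j + (N1 * a i j + N2 * a i j)"
    using ij fin by (simp add: sum.distrib sum_subtractf r_def c_def s_def sum_distrib_left)
  finally show ?thesis by (simp add: algebra_simps r_def c_def s_def)
qed

text \<open>One factor of the square is expanded over the fibres by \<open>sum_evaluation\<close>,
  the other is evaluated by \<open>sum_fibre_evaluation\<close>. For a matrix with zero row and
  column sums only the sum of squares remains.\<close>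

lemma sum_square_evaluation:
  fixes a :: "'i \<Rightarrow> 'j \<Rightarrow> real" and T :: "('i \<Rightarrow> 'j) set"
  assumes fin: "finite T" "finite A" "finite B"
    and maps: "\<And>\<sigma> i. \<sigma> \<in> T \<Longrightarrow> i \<in> A \<Longrightarrow> \<sigma> i \<in> B"
    and inj: "\<And>\<sigma>. \<sigma> \<in> T \<Longrightarrow> inj_on \<sigma> A"
    and N1: "\<And>i j. i \<in> A \<Longrightarrow> j \<in> B \<Longrightarrow> card {\<sigma>\<in>T. \<sigma> i = j} = N1"
    and N2: "\<And>i j i' j'. i \<in> A \<Longrightarrow> j \<in> B \<Longrightarrow> i' \<in> A \<Longrightarrow> j' \<in> B \<Longrightarrow> i \<noteq> i' \<Longrightarrow> j \<noteq> j' \<Longrightarrow>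
      card {\<sigma>\<in>T. \<sigma> i = j \<and> \<sigma> i' = j'} = N2"
  shows "(\<Sum>\<sigma>\<in>T. (\<Sum>i\<in>A. a i (\<sigma> i))\<^sup>2) = N1 * (\<Sum>i\<in>A. \<Sum>j\<in>B. (a i j)\<^sup>2) +
     N2 * ((\<Sum>i\<in>A. \<Sum>j\<in>B. a i j)\<^sup>2 - (\<Sum>i\<in>A. (\<Sum>j\<in>B. a i j)\<^sup>2) - (\<Sum>j\<in>B. (\<Sum>i\<in>A. a i j)\<^sup>2)
       + (\<Sum>i\<in>A. \<Sum>j\<in>B. (a i j)\<^sup>2))"
proof -
  define r where "r i = (\<Sum>j\<in>B. a i j)" for i
  define c where "c j = (\<Sum>i\<in>A. a i j)" for j
  define s where "s = (\<Sum>i\<in>A. \<Sum>j\<in>B. a i j)"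
  have inner: "(\<Sum>\<sigma>\<in>{\<sigma>\<in>T. \<sigma> i = j}. \<Sum>i\<in>A. a i (\<sigma> i)) = N1 * a i j + N2 * (s - r i - c j + a i j)"
    if "i \<in> A" "j \<in> B" for i j
    unfolding r_def c_def s_def by (rule sum_fibre_evaluation) (fact assms that)+
  have "(\<Sum>\<sigma>\<in>T. (\<Sum>i\<in>A. a i (\<sigma> i))\<^sup>2) = (\<Sum>\<sigma>\<in>T. (\<Sum>i\<in>A. a i (\<sigma> i)) * (\<Sum>i\<in>A. a i (\<sigma> i)))"
    by (simp add: power2_eq_square)
  also have "\<dots> = (\<Sum>i\<in>A. \<Sum>j\<in>B. a i j * (N1 * a i j + N2 * (s - r i - c j + a i j)))"
    using sum_evaluation[OF fin, of "\<lambda>\<sigma>. \<Sum>i\<in>A. a i (\<sigma> i)" a] maps by (simp add: inner)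
  also have "\<dots> = (\<Sum>i\<in>A. \<Sum>j\<in>B. N1 * (a i j)\<^sup>2 + N2 * (a i j * s) - N2 * (a i j * r i) - N2 * (a i j * c j) + N2 * (a i j)\<^sup>2)"
    by (intro sum.cong refl) (simp add: algebra_simps power2_eq_square)
  also have "\<dots> = N1 * (\<Sum>i\<in>A. \<Sum>j\<in>B. (a i j)\<^sup>2) + N2 * (\<Sum>i\<in>A. \<Sum>j\<in>B. a i j * s)
     - N2 * (\<Sum>i\<in>A. \<Sum>j\<in>B. a i j * r i) - N2 * (\<Sum>i\<in>A. \<Sum>j\<in>B. a i j * c j) + N2 * (\<Sum>i\<in>A. \<Sum>j\<in>B. (a i j)\<^sup>2)"
    by (simp add: sum.distrib sum_subtractf sum_distrib_left)
  also have "(\<Sum>i\<in>A. \<Sum>j\<in>B. a i j * s) = s\<^sup>2"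
    by (simp add: s_def power2_eq_square sum_distrib_right)
  also have "(\<Sum>i\<in>A. \<Sum>j\<in>B. a i j * r i) = (\<Sum>i\<in>A. (r i)\<^sup>2)"
    by (simp add: r_def power2_eq_square sum_distrib_right)
  also have "(\<Sum>i\<in>A. \<Sum>j\<in>B. a i j * c j) = (\<Sum>j\<in>B. (c j)\<^sup>2)"
    by (subst sum.swap) (simp add: c_def power2_eq_square sum_distrib_right)
  finally show ?thesis
    by (simp add: r_def c_def s_def algebra_simps)
qed

subsection \<open>Boolean functions of degree one\<close>

text \<open>The additive analogue of a 2-by-2 determinant. All minors vanish exactly when
  \<open>a i j\<close> is a function of \<open>i\<close> plus a function of \<open>j\<close>; a
  single one is the loss in the sum of \<open>a i (\<sigma> i)\<close> when two values are
  exchanged.\<close>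

definition minor :: "('a \<Rightarrow> 'b \<Rightarrow> real) \<Rightarrow> 'a \<Rightarrow> 'a \<Rightarrow> 'b \<Rightarrow> 'b \<Rightarrow> real" where
  "minor a p p' q q' = a p q + a p' q' - a p q' - a p' q"

lemma sum_evaluation_transpose:
  assumes "\<sigma> \<in> Sym n" "p \<in> {1..n}" "p' \<in> {1..n}"
  shows "(\<Sum>i\<in>{1..n}. a i ((\<sigma> \<circ> transpose p p') i))
    = (\<Sum>i\<in>{1..n}. a i (\<sigma> i)) - minor a p p' (\<sigma> p) (\<sigma> p')"
proof (cases "p = p'")
  case True
  thus ?thesis by (simp add: minor_def)
next
  case False
  have "(\<Sum>i\<in>{1..n}. a i (\<sigma> i) - a i ((\<sigma> \<circ> transpose p p') i))
      = (\<Sum>i\<in>{p,p'}. a i (\<sigma> i) - a i ((\<sigma> \<circ> transpose p p') i))"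
    by (rule sum.mono_neutral_right) (use assms in \<open>auto simp: transpose_def\<close>)
  also have "\<dots> = minor a p p' (\<sigma> p) (\<sigma> p')"
    using False by (simp add: minor_def)
  finally show ?thesis by (simp add: sum_subtractf)
qed

text \<open>A permutation through all four cells, with sum v, admits two independent exchanges. With
  nonzero minors m and m' the values v, v - m, v - m', v - m - m' cannot all be 0 or 1: the first
  three force m = m', and then the last is -1 or 2.\<close>

lemma disjoint_minors:
  assumes bool: "\<And>\<sigma>. \<sigma> \<in> Sym n \<Longrightarrow> (\<Sum>i\<in>{1..n}. a i (\<sigma> i)) \<in> {0, 1}"
    and "{p,p',r,r'} \<subseteq> {1..n}" "{q,q',s,s'} \<subseteq> {1..n}"
    and disj: "{p,p'} \<inter> {r,r'} = {}" "{q,q'} \<inter> {s,s'} = {}"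
  shows "minor a p p' q q' = 0 \<or> minor a r r' s s' = 0"
proof (rule ccontr)
  assume "\<not> ?thesis"
  hence nz: "minor a p p' q q' \<noteq> 0" "minor a r r' s s' \<noteq> 0" by auto
  hence ne: "p \<noteq> p'" "q \<noteq> q'" "r \<noteq> r'" "s \<noteq> s'" by (auto simp: minor_def)
  let ?g = "\<lambda>x. if x = p then q else if x = p' then q' else if x = r then s else s'"
  have "inj_on ?g {p,p',r,r'}" "?g ` {p,p',r,r'} \<subseteq> {1..n}"
    using assms(2,3) disj ne by (auto simp: inj_on_def)
  then obtain \<sigma> where "\<sigma> permutes {1..n}" and \<sigma>_eq: "\<forall>x\<in>{p,p',r,r'}. \<sigma> x = ?g x"
    using permutation_extending[of "{1..n}" "{p,p',r,r'}" ?g] assms(2) by blast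
  hence \<sigma>: "\<sigma> \<in> Sym n" by (simp add: Sym_def)
  have vals: "\<sigma> p = q" "\<sigma> p' = q'" "\<sigma> r = s" "\<sigma> r' = s'"
    using \<sigma>_eq disj ne by auto
  define f where "f \<sigma> = (\<Sum>i\<in>{1..n}. a i (\<sigma> i))" for \<sigma>
  have comp: "\<sigma> \<circ> transpose x y \<in> Sym n" if "\<sigma> \<in> Sym n" "x \<in> {1..n}" "y \<in> {1..n}" for \<sigma> x y
    using that(1) permutes_compose[OF permutes_swap_id[OF that(2,3)]] by (simp add: Sym_def)
  have fb: "f \<rho> \<in> {0,1}" if "\<rho> \<in> Sym n" for \<rho>
    unfolding f_def by (rule bool[OF that])
  have mem: "p \<in> {1..n}" "p' \<in> {1..n}" "r \<in> {1..n}" "r' \<in> {1..n}" using assms(2) by auto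
  let ?\<sigma>1 = "\<sigma> \<circ> transpose p p'" and ?\<sigma>2 = "\<sigma> \<circ> transpose r r'"
  have s1: "?\<sigma>1 \<in> Sym n" and s2: "?\<sigma>2 \<in> Sym n" by (rule comp[OF \<sigma>]; rule mem)+
  have s3: "?\<sigma>1 \<circ> transpose r r' \<in> Sym n" by (rule comp[OF s1 mem(3,4)])
  \<comment> \<open>The first exchange leaves rows \<open>r\<close> and \<open>r'\<close> alone, so
    the second costs the same minor before and after it.\<close>
  have "?\<sigma>1 r = s" "?\<sigma>1 r' = s'" using vals disj by (auto simp: transpose_def)
  hence "f (?\<sigma>1 \<circ> transpose r r') = f ?\<sigma>1 - minor a r r' s s'"
    using sum_evaluation_transpose[OF s1 mem(3,4), of a] by (simp only: f_def)
  moreover have "f ?\<sigma>1 = f \<sigma> - minor a p p' q q'"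
    using sum_evaluation_transpose[OF \<sigma> mem(1,2), of a] by (simp only: f_def vals)
  moreover have "f ?\<sigma>2 = f \<sigma> - minor a r r' s s'"
    using sum_evaluation_transpose[OF \<sigma> mem(3,4), of a] by (simp only: f_def vals)
  moreover note fb[OF \<sigma>] fb[OF s1] fb[OF s2] fb[OF s3]
  ultimately show False using nz by auto
qed

text \<open>In the next two lemmas \<open>E\<close> and \<open>E'\<close> are complements of equivalence relations.\<close>

lemma intersecting_star:
  assumes V: "finite V" "card V \<ge> 4"
    and irrefl: "\<And>x. \<not> E x x"
    and sym: "\<And>x y. E x y \<Longrightarrow> E y x"
    and split: "\<And>x y z. x \<in> V \<Longrightarrow> y \<in> V \<Longrightarrow> z \<in> V \<Longrightarrow> E x y \<Longrightarrow> E x z \<or> E z y"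
    and meet: "\<And>x y x' y'. x \<in> V \<Longrightarrow> y \<in> V \<Longrightarrow> x' \<in> V \<Longrightarrow> y' \<in> V \<Longrightarrow> E x y \<Longrightarrow> E x' y' \<Longrightarrow> {x,y} \<inter> {x',y'} \<noteq> {}"
  obtains u where "u \<in> V" "\<And>x y. x \<in> V \<Longrightarrow> y \<in> V \<Longrightarrow> E x y \<Longrightarrow> u \<in> {x,y}"
proof (cases "\<exists>u\<in>V. \<exists>v\<in>V. E u v")
  case False
  moreover have "V \<noteq> {}" using V by auto
  ultimately show ?thesis using that by blast
next
  case True
  then obtain u v where uv: "u \<in> V" "v \<in> V" "E u v" by blast
  hence "u \<noteq> v" using irrefl by auto
  \<comment> \<open>By \<open>split\<close>, each of two spare points is joined to \<open>u\<close>
    or \<open>v\<close>; \<open>meet\<close> forces the same endpoint for both, since different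
    endpoints would give disjoint edges.\<close>
  have "card (V - {u,v}) \<ge> 2"
    using V diff_card_le_card_Diff[of "{u,v}" V] by (auto simp: card_insert_if split: if_splits)
  then obtain w w' where w: "w \<in> V" "w' \<in> V" "w \<noteq> w'" "w \<notin> {u,v}" "w' \<notin> {u,v}"
    by (auto simp: card_le_Suc_iff numeral_2_eq_2)
  note witness = that
  \<comment> \<open>Three edges at \<open>z\<close> with distinct far ends: a pair that avoids
    \<open>z\<close> and meets all of them would need three elements.\<close>
  have star: thesis if z: "z \<in> V" "z' \<in> V" "w \<notin> {z,z'}" "w' \<notin> {z,z'}" and e: "E z z'" "E z w" "E z w'" for z z'
  proof (rule witness[OF z(1)])
    fix x y assume "x \<in> V" "y \<in> V" "E x y"
    thus "z \<in> {x,y}"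
      using meet[of x y z z'] meet[of x y z w] meet[of x y z w'] z e w by auto
  qed
  consider "E u w" "E u w'" | "E v w" "E v w'"
  proof -
    have "E u w \<or> E w v" "E u w' \<or> E w' v" using split uv w by auto
    moreover have "\<not> (E u w \<and> E w' v)" "\<not> (E u w' \<and> E w v)"
      using meet[of u w w' v] meet[of u w' w v] uv w \<open>u \<noteq> v\<close> by auto
    ultimately show ?thesis using that sym by blast
  qed
  thus thesis
    using star[of u v] star[of v u] uv w sym[OF uv(3)] by cases auto
qed

lemma cross_intersecting_star:
  assumes V: "finite V" "card V \<ge> 5"
    and sym: "\<And>x y. E x y \<Longrightarrow> E y x" "\<And>x y. E' x y \<Longrightarrow> E' y x"
    and split: "\<And>x y z. x \<in> V \<Longrightarrow> y \<in> V \<Longrightarrow> z \<in> V \<Longrightarrow> E x y \<Longrightarrow> E x z \<or> E z y"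
      "\<And>x y z. x \<in> V \<Longrightarrow> y \<in> V \<Longrightarrow> z \<in> V \<Longrightarrow> E' x y \<Longrightarrow> E' x z \<or> E' z y"
    and meet: "\<And>x y x' y'. x \<in> V \<Longrightarrow> y \<in> V \<Longrightarrow> x' \<in> V \<Longrightarrow> y' \<in> V \<Longrightarrow> E x y \<Longrightarrow> E' x' y' \<Longrightarrow> {x,y} \<inter> {x',y'} \<noteq> {}"
    and uv: "u \<in> V" "v \<in> V" "E u v"
    and uv': "u' \<in> V" "v' \<in> V" "E' u' v'"
  obtains j where "j \<in> V" "\<And>w. w \<in> V \<Longrightarrow> w \<noteq> j \<Longrightarrow> E j w" "\<And>w. w \<in> V \<Longrightarrow> w \<noteq> j \<Longrightarrow> E' j w"
proof -
  \<comment> \<open>If all edges pass through \<open>j\<close>, splitting one of them at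
    \<open>w\<close> can only produce the half that contains \<open>j\<close>.\<close>
  have full: "E1 j w"
    if s1: "\<And>x y. E1 x y \<Longrightarrow> E1 y x"
    and sp: "\<And>x y z. x \<in> V \<Longrightarrow> y \<in> V \<Longrightarrow> z \<in> V \<Longrightarrow> E1 x y \<Longrightarrow> E1 x z \<or> E1 z y"
    and e: "x \<in> V" "y \<in> V" "E1 x y" and c: "\<And>x y. x \<in> V \<Longrightarrow> y \<in> V \<Longrightarrow> E1 x y \<Longrightarrow> j \<in> {x,y}"
    and w: "w \<in> V" "w \<noteq> j" for E1 j w x y
    using sp[OF e(1,2) w(1) e(3)] c[of x y] c[of x w] c[of w y] e w s1 by auto
  \<comment> \<open>Each of three points outside \<open>{u,v}\<close> is joined to \<open>u\<close>
    or \<open>v\<close>, so two of them share an endpoint, the centre of a star with three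
    edges.\<close>
  have "card (V - {u,v}) \<ge> 3"
    using V diff_card_le_card_Diff[of "{u,v}" V] by (auto simp: card_insert_if split: if_splits)
  then obtain w1 w2 w3 where w: "w1 \<in> V" "w2 \<in> V" "w3 \<in> V" "w1 \<noteq> w2" "w1 \<noteq> w3" "w2 \<noteq> w3"
      "w1 \<notin> {u,v}" "w2 \<notin> {u,v}" "w3 \<notin> {u,v}"
    by (auto simp: card_le_Suc_iff numeral_3_eq_3)
  have star: "z \<in> {x,y}" if z: "z \<in> V" "z' \<in> V" "w \<in> V" "w' \<in> V" "w \<notin> {z,z'}" "w' \<notin> {z,z'}" "w \<noteq> w'"
      and e: "E z z'" "E z w" "E z w'" and "x \<in> V" "y \<in> V" "E' x y" for z z' w w' x y
    using meet[of z z' x y] meet[of z w x y] meet[of z w' x y] that by auto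
  have "\<exists>j\<in>V. \<forall>x\<in>V. \<forall>y\<in>V. E' x y \<longrightarrow> j \<in> {x,y}"
  proof -
    have two: "\<exists>j\<in>V. \<forall>x\<in>V. \<forall>y\<in>V. E' x y \<longrightarrow> j \<in> {x,y}"
      if ww: "w \<in> V" "w' \<in> V" "w \<notin> {u,v}" "w' \<notin> {u,v}" "w \<noteq> w'"
        and e: "E u w \<and> E u w' \<or> E v w \<and> E v w'" for w w'
      using e
    proof
      assume "E u w \<and> E u w'"
      thus ?thesis using star[of u v w w'] ww uv by blast
    next
      assume "E v w \<and> E v w'"
      thus ?thesis using star[of v u w w'] ww uv sym(1) by blast
    qed
    have "E u w1 \<or> E v w1" "E u w2 \<or> E v w2" "E u w3 \<or> E v w3"
      using split(1)[OF uv(1,2) _ uv(3)] w sym(1) by blast+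
    then consider "E u w1 \<and> E u w2 \<or> E v w1 \<and> E v w2" | "E u w1 \<and> E u w3 \<or> E v w1 \<and> E v w3"
      | "E u w2 \<and> E u w3 \<or> E v w2 \<and> E v w3" by blast
    thus ?thesis using two w by cases auto
  qed
  then obtain j where j: "j \<in> V" "\<And>x y. x \<in> V \<Longrightarrow> y \<in> V \<Longrightarrow> E' x y \<Longrightarrow> j \<in> {x,y}" by blast
  have f': "E' j w" if "w \<in> V" "w \<noteq> j" for w
    using full[of E' u' v' j w] sym(2) split(2) uv' j(2) that by blast
  have "j \<in> {x,y}" if "x \<in> V" "y \<in> V" "E x y" for x y
  proof (rule ccontr)
    assume n: "j \<notin> {x,y}"
    \<comment> \<open>A further point \<open>w\<close> exists, and the edge \<open>E' j w\<close>
      would be disjoint from \<open>{x,y}\<close>.\<close>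
    have "\<not> V \<subseteq> {j,x,y}"
      using V card_mono[of "{j,x,y}" V] by (auto simp: card_insert_if split: if_splits)
    then obtain w where "w \<in> V" "w \<notin> {j,x,y}" by blast
    thus False using meet[of x y j w] f'[of w] that j(1) n by auto
  qed
  hence "E j w" if "w \<in> V" "w \<noteq> j" for w
    using full[of E u v j w] sym(1) split(1) uv that by blast
  with j(1) f' show thesis using that by blast
qed

text \<open>In the proof, \<open>R p p'\<close> says that rows \<open>p\<close> and
  \<open>p'\<close> carry a nonzero minor. If any two such row pairs meet,
  \<open>intersecting_star\<close> gives a common row. Otherwise the column pairs of two disjoint
  row pairs cross-intersect; this gives a column \<open>j\<close> that forms a nonzero minor with
  every other column in both row pairs, which forces \<open>j\<close> into all nonzero
  minors.\<close>

lemma minors_avoid_line: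
  fixes a :: "'a \<Rightarrow> 'a \<Rightarrow> real"
  assumes V: "finite V" "card V \<ge> 5"
    and disj: "\<And>p p' r r' q q' s s'. {p,p',r,r'} \<subseteq> V \<Longrightarrow> {q,q',s,s'} \<subseteq> V \<Longrightarrow>
      {p,p'} \<inter> {r,r'} = {} \<Longrightarrow> {q,q'} \<inter> {s,s'} = {} \<Longrightarrow> minor a p p' q q' = 0 \<or> minor a r r' s s' = 0"
  obtains u where "u \<in> V" "\<And>p p' q q'. {p,p'} \<subseteq> V - {u} \<Longrightarrow> {q,q'} \<subseteq> V \<Longrightarrow> minor a p p' q q' = 0"
  | u where "u \<in> V" "\<And>p p' q q'. {p,p'} \<subseteq> V \<Longrightarrow> {q,q'} \<subseteq> V - {u} \<Longrightarrow> minor a p p' q q' = 0"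
proof -
  define bad where "bad p p' q q' \<longleftrightarrow> minor a p p' q q' \<noteq> 0" for p p' q q'
  define R where "R p p' \<longleftrightarrow> (\<exists>q\<in>V. \<exists>q'\<in>V. bad p p' q q')" for p p'
  have col_sym: "bad p p' q' q" and row_sym: "bad p' p q q'" if "bad p p' q q'" for p p' q q'
    using that by (auto simp: bad_def minor_def)
  have col_split: "bad p p' q x \<or> bad p p' x q'" and row_split: "bad p x q q' \<or> bad x p' q q'"
    if "bad p p' q q'" for p p' q q' x
    using that by (auto simp: bad_def minor_def)
  show thesis
  proof (cases "\<exists>p1\<in>V. \<exists>p1'\<in>V. \<exists>p2\<in>V. \<exists>p2'\<in>V. R p1 p1' \<and> R p2 p2' \<and> {p1,p1'} \<inter> {p2,p2'} = {}")
    case False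
    obtain u where "u \<in> V" "\<And>x y. x \<in> V \<Longrightarrow> y \<in> V \<Longrightarrow> R x y \<Longrightarrow> u \<in> {x,y}"
    proof (rule intersecting_star[of V R])
      show "\<not> R x x" for x by (simp add: R_def bad_def minor_def)
      show "R y x" if "R x y" for x y using that row_sym unfolding R_def by blast
      show "R x z \<or> R z y" if "R x y" for x y z using that row_split unfolding R_def by blast
      show "{x,y} \<inter> {x',y'} \<noteq> {}"
        if "x \<in> V" "y \<in> V" "x' \<in> V" "y' \<in> V" "R x y" "R x' y'" for x y x' y'
        using False that by blast
    qed (use V in auto)
    thus thesis by (intro that(1)[of u]) (auto simp: R_def bad_def)
  next
    case True
    then obtain p1 p1' p2 p2' where p: "p1 \<in> V" "p1' \<in> V" "p2 \<in> V" "p2' \<in> V"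
      "R p1 p1'" "R p2 p2'" "{p1,p1'} \<inter> {p2,p2'} = {}" by blast
    obtain q1 q1' q2 q2' where q: "q1 \<in> V" "q1' \<in> V" "bad p1 p1' q1 q1'" "q2 \<in> V" "q2' \<in> V" "bad p2 p2' q2 q2'"
      using p(5,6) unfolding R_def by blast
    have meet: "{x,y} \<inter> {x',y'} \<noteq> {}" if "x \<in> V" "y \<in> V" "x' \<in> V" "y' \<in> V" "{r,r',s,s'} \<subseteq> V"
      "bad r r' x y" "bad s s' x' y'" "{r,r'} \<inter> {s,s'} = {}" for x y x' y' r r' s s'
      using disj[of r r' s s' x y x' y'] that by (auto simp: bad_def)
    obtain j where j: "j \<in> V" "\<And>w. w \<in> V \<Longrightarrow> w \<noteq> j \<Longrightarrow> bad p1 p1' j w" "\<And>w. w \<in> V \<Longrightarrow> w \<noteq> j \<Longrightarrow> bad p2 p2' j w"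
    proof (rule cross_intersecting_star[of V "bad p1 p1'" "bad p2 p2'" q1 q1' q2 q2'])
      show "{x,y} \<inter> {x',y'} \<noteq> {}" if "x \<in> V" "y \<in> V" "x' \<in> V" "y' \<in> V"
        "bad p1 p1' x y" "bad p2 p2' x' y'" for x y x' y'
        using meet[OF that(1-4) _ that(5,6)] p by blast
    qed (use V q col_sym col_split in blast)+
    \<comment> \<open>If \<open>j\<close> were missing, a column \<open>w\<close> outside
      \<open>{j,q,q'}\<close> would give a nonzero minor of the reference rows in columns
      \<open>j\<close> and \<open>w\<close>, disjoint from the given one in rows and
      columns.\<close>
    have far: "j \<in> {q,q'}" if "r \<in> V" "r' \<in> V" "q \<in> V" "q' \<in> V" "bad r r' q q'"
      "{r,r'} \<inter> {p1,p1'} = {} \<or> {r,r'} \<inter> {p2,p2'} = {}" for r r' q q'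
    proof (rule ccontr)
      assume n: "j \<notin> {q,q'}"
      have "\<not> V \<subseteq> {j,q,q'}"
        using V card_mono[of "{j,q,q'}" V] by (auto simp: card_insert_if split: if_splits)
      then obtain w where "w \<in> V" "w \<noteq> j" "w \<notin> {q,q'}" by blast
      thus False
        using meet[of q q' j w r r' p1 p1'] meet[of q q' j w r r' p2 p2'] j that n p by auto
    qed
    \<comment> \<open>Any row pair can be split at a row \<open>x\<close> outside both reference
      pairs, and a pair containing \<open>x\<close> misses at least one of them.\<close>
    have "\<not> V \<subseteq> {p1,p1',p2,p2'}"
      using V card_mono[of "{p1,p1',p2,p2'}" V] by (auto simp: card_insert_if split: if_splits)
    then obtain x where x: "x \<in> V" "x \<notin> {p1,p1',p2,p2'}" by blast
    have "j \<in> {q,q'}" if r: "r \<in> V" "r' \<in> V" "q \<in> V" "q' \<in> V" "bad r r' q q'" for r r' q q'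
    proof -
      have "j \<in> {q,q'}" if "bad y x q q'" "y \<in> V" for y
      proof -
        have "{y,x} \<inter> {p1,p1'} = {} \<or> {y,x} \<inter> {p2,p2'} = {}" using x p(7) by auto
        thus ?thesis using far that r x by blast
      qed
      thus ?thesis using row_split[OF r(5), of x] row_sym r by blast
    qed
    thus thesis by (intro that(2)[of j] j(1)) (auto simp: bad_def)
  qed
qed

text \<open>Outside row \<open>u\<close> the matrix is \<open>a r j\<close> plus a constant
  depending on the row. Since \<sigma> hits every column once, summing
  \<open>a r (\<sigma> i)\<close> over the rows other than \<open>u\<close> gives a full row sum
  minus \<open>a r (\<sigma> u)\<close>.\<close>

lemma sum_depends_on_one_value:
  fixes a :: "nat \<Rightarrow> nat \<Rightarrow> real"
  assumes n: "n \<ge> 2" and u: "u \<in> {1..n}"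
    and minor: "\<And>p p' q q'. {p,p'} \<subseteq> {1..n} - {u} \<Longrightarrow> {q,q'} \<subseteq> {1..n} \<Longrightarrow> minor a p p' q q' = 0"
  shows "\<exists>b. \<forall>\<sigma>\<in>Sym n. (\<Sum>i\<in>{1..n}. a i (\<sigma> i)) = b (\<sigma> u)"
proof -
  define r where "r = (if u = 1 then 2 else 1 :: nat)"
  have r: "r \<in> {1..n} - {u}" using n by (auto simp: r_def)
  have eq: "a i j = a r j + (a i 1 - a r 1)" if "i \<in> {1..n} - {u}" "j \<in> {1..n}" for i j
    using minor[of i r j 1] that r n by (auto simp: minor_def)
  define b where "b j = a u j + ((\<Sum>j\<in>{1..n}. a r j) - a r j
        + (\<Sum>i\<in>{1..n} - {u}. a i 1 - a r 1))" for j
  show ?thesis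
  proof (intro exI[of _ b] ballI)
    fix \<sigma> assume \<sigma>: "\<sigma> \<in> Sym n"
    have "(\<Sum>i\<in>{1..n} - {u}. a i (\<sigma> i)) = (\<Sum>i\<in>{1..n} - {u}. a r (\<sigma> i) + (a i 1 - a r 1))"
      by (intro sum.cong refl eq) (use \<sigma> in \<open>auto simp del: atLeastAtMost_iff One_nat_def\<close>)
    also have "\<dots> = (\<Sum>i\<in>{1..n}. a r (\<sigma> i)) - a r (\<sigma> u) + (\<Sum>i\<in>{1..n} - {u}. a i 1 - a r 1)"
      using u by (simp add: sum.distrib sum_diff1)
    also have "(\<Sum>i\<in>{1..n}. a r (\<sigma> i)) = (\<Sum>j\<in>{1..n}. a r j)"
      using \<sigma> by (intro sum.reindex_bij_betw permutes_imp_bij) (simp add: Sym_def)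
    finally show "(\<Sum>i\<in>{1..n}. a i (\<sigma> i)) = b (\<sigma> u)"
      using u by (simp add: b_def sum.remove[of _ u])
  qed
qed

section \<open>Boolean functions of degree one are dictators\<close>

lemma inv_in_Sym: "\<sigma> \<in> Sym n \<Longrightarrow> inv \<sigma> \<in> Sym n"
  by (simp add: Sym_def permutes_inv)

lemma sum_evaluation_inv:
  assumes "\<sigma> \<in> Sym n"
  shows "(\<Sum>j\<in>{1..n}. a (inv \<sigma> j) j) = (\<Sum>i\<in>{1..n}. a i (\<sigma> i))"
proof -
  have \<sigma>: "\<sigma> permutes {1..n}" using assms by (simp add: Sym_def)
  have "(\<Sum>i\<in>{1..n}. a (inv \<sigma> (\<sigma> i)) (\<sigma> i)) = (\<Sum>j\<in>{1..n}. a (inv \<sigma> j) j)"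
    by (rule sum.reindex_bij_betw[OF permutes_imp_bij[OF \<sigma>]])
  thus ?thesis by (simp add: permutes_inverses[OF \<sigma>])
qed

text \<open>The common line of the nonzero minors is a row or a column. Transposing \<open>a\<close>
  and inverting \<sigma> reduces the column case to the row case.\<close>

theorem Boolean_degree_one:
  fixes a :: "nat \<Rightarrow> nat \<Rightarrow> real"
  assumes n: "n \<ge> 5"
    and bool: "\<And>\<sigma>. \<sigma> \<in> Sym n \<Longrightarrow> (\<Sum>i\<in>{1..n}. a i (\<sigma> i)) \<in> {0, 1}"
  obtains u J where "u \<in> {1..n}" "J \<subseteq> {1..n}"
      "{\<sigma>\<in>Sym n. (\<Sum>i\<in>{1..n}. a i (\<sigma> i)) = 1} = {\<sigma>\<in>Sym n. \<sigma> u \<in> J}"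
  | u J where "u \<in> {1..n}" "J \<subseteq> {1..n}"
      "{\<sigma>\<in>Sym n. (\<Sum>i\<in>{1..n}. a i (\<sigma> i)) = 1} = {\<sigma>\<in>Sym n. inv \<sigma> u \<in> J}"
proof -
  have n2: "n \<ge> 2" using n by simp
  have "finite {1..n}" "5 \<le> card {1..n}" using n by auto
  thus thesis
  proof (rule minors_avoid_line[where a = a])
    show "minor a p p' q q' = 0 \<or> minor a r r' s s' = 0"
      if "{p,p',r,r'} \<subseteq> {1..n}" "{q,q',s,s'} \<subseteq> {1..n}" "{p,p'} \<inter> {r,r'} = {}" "{q,q'} \<inter> {s,s'} = {}"
      for p p' r r' q q' s s'
      by (rule disjoint_minors[of n a, OF bool that])
  next
    fix u assume u: "u \<in> {1..n}"
      "\<And>p p' q q'. {p,p'} \<subseteq> {1..n} - {u} \<Longrightarrow> {q,q'} \<subseteq> {1..n} \<Longrightarrow> minor a p p' q q' = 0"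
    obtain b where b: "\<forall>\<sigma>\<in>Sym n. (\<Sum>i\<in>{1..n}. a i (\<sigma> i)) = b (\<sigma> u)"
      using sum_depends_on_one_value[OF n2 u] ..
    have "{\<sigma>\<in>Sym n. (\<Sum>i\<in>{1..n}. a i (\<sigma> i)) = 1} = {\<sigma>\<in>Sym n. \<sigma> u \<in> {j\<in>{1..n}. b j = 1}}"
      using b u(1) by (auto simp del: atLeastAtMost_iff One_nat_def)
    thus thesis by (rule that(1)[OF u(1), rotated]) auto
  next
    fix u assume u: "u \<in> {1..n}"
      "\<And>p p' q q'. {p,p'} \<subseteq> {1..n} \<Longrightarrow> {q,q'} \<subseteq> {1..n} - {u} \<Longrightarrow> minor a p p' q q' = 0"
    have "minor (\<lambda>i j. a j i) p p' q q' = 0" if "{p,p'} \<subseteq> {1..n} - {u}" "{q,q'} \<subseteq> {1..n}" for p p' q q'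
      using u(2)[OF that(2,1)] by (simp add: minor_def)
    from sum_depends_on_one_value[OF n2 u(1) this]
    obtain b where "\<forall>\<sigma>\<in>Sym n. (\<Sum>i\<in>{1..n}. a (\<sigma> i) i) = b (\<sigma> u)" ..
    hence b: "(\<Sum>i\<in>{1..n}. a i (\<sigma> i)) = b (inv \<sigma> u)" if "\<sigma> \<in> Sym n" for \<sigma>
      using sum_evaluation_inv[OF that, of a] inv_in_Sym[OF that] by simp
    have "{\<sigma>\<in>Sym n. (\<Sum>i\<in>{1..n}. a i (\<sigma> i)) = 1} = {\<sigma>\<in>Sym n. inv \<sigma> u \<in> {j\<in>{1..n}. b j = 1}}"
      using b u(1) inv_in_Sym by (auto simp del: atLeastAtMost_iff One_nat_def)
    thus thesis by (rule that(2)[OF u(1), rotated]) auto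
  qed
qed

subsection \<open>The degree-one projection\<close>

locale permutation_family =
  fixes n :: nat and F :: "(nat \<Rightarrow> nat) set"
  assumes n: "n \<ge> 5" and F: "F \<subseteq> Sym n"
begin

definition V :: "nat set" where "V = {1..n}"
definition M :: real where "M = fact (n - 1)"
definition f :: "(nat \<Rightarrow> nat) \<Rightarrow> real" where "f \<sigma> = of_bool (\<sigma> \<in> F)"
definition \<kappa> :: real where "\<kappa> = card F / M"
definition \<alpha> :: real where "\<alpha> = \<kappa> / n"
text \<open>The reciprocal of n/(n - 1), the factor between the average of \<open>g\<close> over a
  coset and the entry of \<open>y\<close> (\<open>sum_g_coset\<close>). It normalises
  \<open>h\<close> to be an orthogonal projection.\<close>

definition t :: real where "t = (n - 1) / n"
definition x :: "nat \<Rightarrow> nat \<Rightarrow> real" where "x i j = card {\<sigma>\<in>F. \<sigma> i = j} / M"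
definition y :: "nat \<Rightarrow> nat \<Rightarrow> real" where "y i j = x i j - \<alpha>"
definition S :: real where "S = (\<Sum>i\<in>V. \<Sum>j\<in>V. (y i j)\<^sup>2)"
definition g :: "(nat \<Rightarrow> nat) \<Rightarrow> real" where "g \<sigma> = (\<Sum>i\<in>V. y i (\<sigma> i))"
definition h :: "(nat \<Rightarrow> nat) \<Rightarrow> real" where "h \<sigma> = \<alpha> + t * g \<sigma>"
definition e :: "(nat \<Rightarrow> nat) \<Rightarrow> real" where "e \<sigma> = f \<sigma> - h \<sigma>"
text \<open>The squared distance of \<open>f\<close> from \<open>h\<close>, divided by
  \<open>M\<close>; see \<open>sum_e_square\<close>.\<close>

definition \<rho> :: real where "\<rho> = \<kappa> - \<alpha> * \<kappa> - t * S"

abbreviation coset :: "nat \<Rightarrow> nat \<Rightarrow> (nat \<Rightarrow> nat) set" where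
  "coset i j \<equiv> {\<sigma>\<in>Sym n. \<sigma> i = j}"

section \<open>Coset densities, their row and column sums, and the total intersection number\<close>

lemma finite_V [simp]: "finite V" and card_V [simp]: "card V = n"
  by (simp_all add: V_def)

lemma Sym_V: "\<sigma> \<in> Sym n \<Longrightarrow> i \<in> V \<Longrightarrow> \<sigma> i \<in> V"
  unfolding V_def by (simp only: Sym_in)

lemma Sym_inj_on: "\<sigma> \<in> Sym n \<Longrightarrow> inj_on \<sigma> A"
  by (simp add: inj_on_def Sym_inj)

lemma finite_F [simp]: "finite F"
  using F finite_subset finite_Sym by blast

lemma M_pos: "M > 0" by (simp add: M_def)

lemma fact_n: "(fact n :: real) = n * M"
  unfolding M_def using n by (subst fact_reduce) auto

lemma fact_n2: "real (fact (n - 2)) = M / (real n - 1)"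
proof -
  have "(fact (n - 1) :: real) = real (n - 1) * fact (n - 1 - 1)"
    using n by (intro fact_reduce) auto
  moreover have "n - 1 - 1 = n - 2" by simp
  ultimately show ?thesis using n by (simp add: M_def of_nat_diff)
qed

lemma fact_n3: "real (fact (n - 3)) = M / ((real n - 1) * (real n - 2))"
proof -
  have "(fact (n - 2) :: real) = real (n - 2) * fact (n - 2 - 1)"
    using n by (intro fact_reduce) auto
  moreover have "n - 2 - 1 = n - 3" by simp
  ultimately have "(fact (n - 2) :: real) = (real n - 2) * fact (n - 3)" using n by (simp add: of_nat_diff)
  hence "(fact (n - 3) :: real) = fact (n - 2) / (real n - 2)" using n by (simp add: field_simps)
  thus ?thesis using fact_n2 by simp
qed

lemma card_coset: "i \<in> V \<Longrightarrow> j \<in> V \<Longrightarrow> card (coset i j) = fact (n - 1)"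
  unfolding V_def by (rule card_one_coset)

lemma sum_f_coset: "(\<Sum>\<sigma>\<in>coset i j. f \<sigma>) = M * x i j"
proof -
  have "(\<Sum>\<sigma>\<in>coset i j. f \<sigma>) = card {\<sigma>\<in>F. \<sigma> i = j}"
    unfolding f_def using F by (subst sum_of_bool_eq) (auto intro!: arg_cong[where f = card])
  thus ?thesis using M_pos by (simp add: x_def)
qed

lemma sum_f: "(\<Sum>\<sigma>\<in>Sym n. f \<sigma>) = M * \<kappa>"
proof -
  have "(\<Sum>\<sigma>\<in>Sym n. f \<sigma>) = card F"
    unfolding f_def using F by (subst sum_of_bool_eq) (auto intro!: arg_cong[where f = card])
  thus ?thesis using M_pos by (simp add: \<kappa>_def)
qed

lemma sum_over_values:
  assumes "i \<in> V"
  shows "(\<Sum>j\<in>V. \<Sum>\<sigma>\<in>coset i j. w \<sigma>) = (\<Sum>\<sigma>\<in>Sym n. w \<sigma> :: real)"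
  by (rule sum.group) (use assms Sym_V in auto)

lemma coset_inv: "i \<in> V \<Longrightarrow> \<sigma> \<in> Sym n \<Longrightarrow> \<sigma> i = j \<longleftrightarrow> inv \<sigma> j = i"
  by (auto simp: Sym_def permutes_inv_eq permutes_inverses)

lemma sum_over_arguments:
  assumes "j \<in> V"
  shows "(\<Sum>i\<in>V. \<Sum>\<sigma>\<in>coset i j. w \<sigma>) = (\<Sum>\<sigma>\<in>Sym n. w \<sigma> :: real)"
proof -
  have "coset i j = {\<sigma>\<in>Sym n. inv \<sigma> j = i}" if "i \<in> V" for i
    using coset_inv[OF that] by auto
  hence "(\<Sum>i\<in>V. \<Sum>\<sigma>\<in>coset i j. w \<sigma>) = (\<Sum>i\<in>V. \<Sum>\<sigma>\<in>{\<sigma>\<in>Sym n. inv \<sigma> j = i}. w \<sigma>)"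
    by simp
  also have "\<dots> = (\<Sum>\<sigma>\<in>Sym n. w \<sigma>)"
    by (rule sum.group) (use assms Sym_V inv_in_Sym in auto)
  finally show ?thesis .
qed

lemma row_x: "i \<in> V \<Longrightarrow> (\<Sum>j\<in>V. x i j) = \<kappa>"
  using sum_over_values[of i f] M_pos by (simp add: sum_f_coset sum_f flip: sum_distrib_left)

lemma col_x: "j \<in> V \<Longrightarrow> (\<Sum>i\<in>V. x i j) = \<kappa>"
  using sum_over_arguments[of j f] M_pos by (simp add: sum_f_coset sum_f flip: sum_distrib_left)

lemma n\<alpha>: "real n * \<alpha> = \<kappa>" using n by (simp add: \<alpha>_def)

lemma row_y: "i \<in> V \<Longrightarrow> (\<Sum>j\<in>V. y i j) = 0"
  by (simp add: y_def sum_subtractf row_x n\<alpha>)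

lemma col_y: "j \<in> V \<Longrightarrow> (\<Sum>i\<in>V. y i j) = 0"
  by (simp add: y_def sum_subtractf col_x n\<alpha>)

lemma x_nonneg: "x i j \<ge> 0" using M_pos by (simp add: x_def)

lemma x_le_1:
  assumes "i \<in> V" "j \<in> V"
  shows "x i j \<le> 1"
proof -
  have "card {\<sigma>\<in>F. \<sigma> i = j} \<le> card (coset i j)"
    using F by (intro card_mono) auto
  hence "real (card {\<sigma>\<in>F. \<sigma> i = j}) \<le> M"
    using card_coset[OF assms] unfolding M_def by (metis of_nat_fact of_nat_le_iff)
  thus ?thesis using M_pos by (simp add: x_def)
qed

lemma \<kappa>_nonneg: "\<kappa> \<ge> 0" using M_pos by (simp add: \<kappa>_def)

lemma \<kappa>_le_n: "\<kappa> \<le> n"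
proof -
  have "card F \<le> fact n" using F card_mono[OF finite_Sym F] by (simp add: card_Sym)
  hence "real (card F) \<le> fact n" by (metis of_nat_fact of_nat_le_iff)
  thus ?thesis using M_pos by (simp add: \<kappa>_def fact_n field_simps)
qed

lemma \<alpha>_bounds: "0 \<le> \<alpha>" "\<alpha> \<le> 1"
  using \<kappa>_nonneg \<kappa>_le_n n by (auto simp: \<alpha>_def field_simps)

lemma abs_y_le_1: "i \<in> V \<Longrightarrow> j \<in> V \<Longrightarrow> \<bar>y i j\<bar> \<le> 1"
  using x_nonneg[of i j] x_le_1[of i j] \<alpha>_bounds by (auto simp: y_def)

lemma t_bounds: "0 < t" "t \<le> 1" using n by (auto simp: t_def)

lemma S_nonneg: "S \<ge> 0" unfolding S_def by (intro sum_nonneg) auto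

lemma sum_x_squares: "(\<Sum>i\<in>V. \<Sum>j\<in>V. (x i j)\<^sup>2) = S + \<kappa>\<^sup>2"
proof -
  have "(\<Sum>j\<in>V. (x i j)\<^sup>2) = (\<Sum>j\<in>V. (y i j)\<^sup>2) + n * \<alpha>\<^sup>2" if "i \<in> V" for i
  proof -
    have "(\<Sum>j\<in>V. (x i j)\<^sup>2) = (\<Sum>j\<in>V. (y i j)\<^sup>2 + 2 * \<alpha> * y i j + \<alpha>\<^sup>2)"
      by (intro sum.cong refl) (simp add: y_def power2_eq_square algebra_simps)
    also have "\<dots> = (\<Sum>j\<in>V. (y i j)\<^sup>2) + 2 * \<alpha> * (\<Sum>j\<in>V. y i j) + n * \<alpha>\<^sup>2"
      by (simp add: sum.distrib sum_distrib_left)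
    finally show ?thesis using row_y[OF that] by simp
  qed
  hence "(\<Sum>i\<in>V. \<Sum>j\<in>V. (x i j)\<^sup>2) = S + n * (n * \<alpha>\<^sup>2)"
    by (simp add: sum.distrib S_def)
  also have "n * (n * \<alpha>\<^sup>2) = (n * \<alpha>)\<^sup>2" by (simp add: power2_eq_square)
  finally show ?thesis by (simp only: n\<alpha>)
qed

text \<open>The ordered pairs that agree at \<open>i\<close> with common value \<open>j\<close>
  number \<open>(M * x i j)\<^sup>2\<close>. Centring the densities at \<alpha> splits off the
  square of \<kappa>.\<close>

lemma total_intersection_eq: "real (total_intersection n F) = M\<^sup>2 * (S + \<kappa>\<^sup>2)"
proof -
  have "total_intersection n F = (\<Sum>A\<in>F. \<Sum>B\<in>F. \<Sum>i\<in>V. of_bool (A i = B i))"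
    unfolding total_intersection_def V_def[symmetric] by (intro sum.cong refl) (simp add: Int_def)
  hence "real (total_intersection n F) = (\<Sum>A\<in>F. \<Sum>B\<in>F. \<Sum>i\<in>V. of_bool (A i = B i))"
    by simp
  also have "\<dots> = (\<Sum>A\<in>F. \<Sum>i\<in>V. \<Sum>B\<in>F. of_bool (A i = B i))"
    by (intro sum.cong refl sum.swap)
  also have "\<dots> = (\<Sum>A\<in>F. \<Sum>i\<in>V. M * x i (A i))"
  proof (intro sum.cong refl)
    fix A i
    have "F \<inter> {B. A i = B i} = {\<sigma>\<in>F. \<sigma> i = A i}" by auto
    thus "(\<Sum>B\<in>F. of_bool (A i = B i)) = M * x i (A i)"
      using M_pos by (simp add: sum_of_bool_eq x_def)
  qed
  also have "\<dots> = (\<Sum>\<sigma>\<in>F. 1 * (\<Sum>i\<in>V. M * x i (\<sigma> i)))" by simp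
  also have "\<dots> = (\<Sum>i\<in>V. \<Sum>j\<in>V. M * x i j * (\<Sum>\<sigma>\<in>{\<sigma>\<in>F. \<sigma> i = j}. 1))"
    by (rule sum_evaluation) (use F Sym_V in auto)
  also have "\<dots> = (\<Sum>i\<in>V. \<Sum>j\<in>V. M\<^sup>2 * (x i j)\<^sup>2)"
    using M_pos by (intro sum.cong refl) (simp add: x_def power2_eq_square)
  finally show ?thesis by (simp add: sum_x_squares flip: sum_distrib_left)
qed

section \<open>Orthogonality and squared distance\<close>

lemma sum_g_weighted: "(\<Sum>\<sigma>\<in>Sym n. w \<sigma> * g \<sigma>) = (\<Sum>i\<in>V. \<Sum>j\<in>V. y i j * (\<Sum>\<sigma>\<in>coset i j. w \<sigma>))"
  unfolding g_def by (rule sum_evaluation) (use Sym_V in auto)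

text \<open>Rows and columns of \<open>y\<close> sum to zero, so only the cell itself contributes,
  with weight \<open>fact (n - 1) + fact (n - 2)\<close>.\<close>

lemma sum_g_coset:
  assumes "i \<in> V" "j \<in> V"
  shows "(\<Sum>\<sigma>\<in>coset i j. g \<sigma>) = M * (real n / (real n - 1)) * y i j"
proof -
  have "(\<Sum>\<sigma>\<in>coset i j. g \<sigma>) = real (fact (n - 1)) * y i j
    + real (fact (n - 2)) * ((\<Sum>i\<in>V. \<Sum>j\<in>V. y i j) - (\<Sum>j\<in>V. y i j) - (\<Sum>i\<in>V. y i j) + y i j)"
    unfolding g_def
    by (rule sum_fibre_evaluation)
      (use assms Sym_V Sym_inj_on card_two_cosets card_one_coset in \<open>auto simp: V_def\<close>)
  also have "\<dots> = M * y i j + M / (real n - 1) * y i j"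
    using assms fact_n2 by (simp add: row_y col_y M_def)
  also have "\<dots> = M * (real n / (real n - 1)) * y i j"
    using n by (simp add: field_simps)
  finally show ?thesis .
qed

lemma t_inverse: "t * (real n / (real n - 1)) = 1"
  using n by (simp add: t_def)

text \<open>Orthogonality to every coset indicator makes \<open>h\<close>, which lies in the span of
  these indicators, the orthogonal projection of \<open>f\<close>.\<close>

lemma sum_e_coset:
  assumes "i \<in> V" "j \<in> V"
  shows "(\<Sum>\<sigma>\<in>coset i j. e \<sigma>) = 0"
proof -
  have "(\<Sum>\<sigma>\<in>coset i j. e \<sigma>) = M * x i j - (M * \<alpha> + t * (\<Sum>\<sigma>\<in>coset i j. g \<sigma>))"
    using card_coset[OF assms]
    by (simp add: e_def h_def sum_subtractf sum.distrib sum_f_coset M_def sum_distrib_left)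
  also have "t * (\<Sum>\<sigma>\<in>coset i j. g \<sigma>) = (t * (real n / (real n - 1))) * (M * y i j)"
    by (simp add: sum_g_coset[OF assms])
  also have "M * x i j - (M * \<alpha> + \<dots>) = 0"
    by (simp only: t_inverse) (simp add: y_def algebra_simps)
  finally show ?thesis .
qed

lemma sum_e_g: "(\<Sum>\<sigma>\<in>Sym n. e \<sigma> * g \<sigma>) = 0"
  by (simp add: sum_g_weighted sum_e_coset)

lemma sum_e: "(\<Sum>\<sigma>\<in>Sym n. e \<sigma>) = 0"
proof -
  have "1 \<in> V" using n by (simp add: V_def)
  thus ?thesis using sum_over_values[of 1 e] by (simp add: sum_e_coset)
qed

lemma sum_e_h: "(\<Sum>\<sigma>\<in>Sym n. e \<sigma> * h \<sigma>) = 0"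
proof -
  have "(\<Sum>\<sigma>\<in>Sym n. e \<sigma> * h \<sigma>) = \<alpha> * (\<Sum>\<sigma>\<in>Sym n. e \<sigma>) + t * (\<Sum>\<sigma>\<in>Sym n. e \<sigma> * g \<sigma>)"
    by (simp add: h_def algebra_simps sum.distrib sum_distrib_left)
  thus ?thesis by (simp add: sum_e sum_e_g)
qed

lemma sum_y_x: "(\<Sum>i\<in>V. \<Sum>j\<in>V. y i j * x i j) = S"
proof -
  have "(\<Sum>j\<in>V. y i j * x i j) = (\<Sum>j\<in>V. (y i j)\<^sup>2)" if "i \<in> V" for i
  proof -
    have "(\<Sum>j\<in>V. y i j * x i j) = (\<Sum>j\<in>V. (y i j)\<^sup>2 + \<alpha> * y i j)"
      by (intro sum.cong refl) (simp add: y_def power2_eq_square algebra_simps)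
    thus ?thesis using row_y[OF that] by (simp add: sum.distrib flip: sum_distrib_left)
  qed
  thus ?thesis by (simp add: S_def)
qed

lemma sum_f_h: "(\<Sum>\<sigma>\<in>Sym n. f \<sigma> * h \<sigma>) = M * (\<kappa> - \<rho>)"
proof -
  have "(\<Sum>\<sigma>\<in>Sym n. f \<sigma> * h \<sigma>) = \<alpha> * (\<Sum>\<sigma>\<in>Sym n. f \<sigma>) + t * (\<Sum>\<sigma>\<in>Sym n. f \<sigma> * g \<sigma>)"
    by (simp add: h_def algebra_simps sum.distrib sum_distrib_left)
  also have "(\<Sum>\<sigma>\<in>Sym n. f \<sigma> * g \<sigma>) = M * (\<Sum>i\<in>V. \<Sum>j\<in>V. y i j * x i j)"
    unfolding sum_g_weighted sum_f_coset sum_distrib_left by (intro sum.cong refl) simp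
  finally show ?thesis by (simp only: sum_f sum_y_x) (simp add: \<rho>_def algebra_simps)
qed

lemma f_square: "f \<sigma> * f \<sigma> = f \<sigma>" by (simp add: f_def)

lemma sum_f_e: "(\<Sum>\<sigma>\<in>Sym n. f \<sigma> * e \<sigma>) = M * \<rho>"
proof -
  have "(\<Sum>\<sigma>\<in>Sym n. f \<sigma> * e \<sigma>) = (\<Sum>\<sigma>\<in>Sym n. f \<sigma> - f \<sigma> * h \<sigma>)"
    by (simp add: e_def algebra_simps f_square)
  thus ?thesis by (simp add: sum_subtractf sum_f sum_f_h algebra_simps)
qed

text \<open>Pointwise the square of \<open>e\<close> is \<open>f * e - e * h\<close>, and
  \<open>e\<close> is orthogonal to \<open>h\<close>.\<close>

lemma sum_e_square: "(\<Sum>\<sigma>\<in>Sym n. (e \<sigma>)\<^sup>2) = M * \<rho>"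
proof -
  have "(\<Sum>\<sigma>\<in>Sym n. (e \<sigma>)\<^sup>2) = (\<Sum>\<sigma>\<in>Sym n. f \<sigma> * e \<sigma> - e \<sigma> * h \<sigma>)"
    by (simp add: e_def algebra_simps power2_eq_square)
  thus ?thesis by (simp add: sum_subtractf sum_f_e sum_e_h)
qed

lemma \<rho>_nonneg: "\<rho> \<ge> 0"
proof -
  have "0 \<le> M * \<rho>" unfolding sum_e_square[symmetric] by (intro sum_nonneg) auto
  thus ?thesis using M_pos by (simp add: zero_le_mult_iff)
qed

text \<open>Nonnegativity of \<rho> gives \<open>t * S \<le> \<kappa>\<close>; dividing by
  \<open>t\<close> costs a relative error 1/(n - 1), which is at most 2/n.\<close>

lemma S_le: "S \<le> \<kappa> + 2 * \<kappa> / n"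
proof -
  have "t * S \<le> \<kappa>"
    using \<rho>_nonneg mult_nonneg_nonneg[OF \<alpha>_bounds(1) \<kappa>_nonneg] by (simp add: \<rho>_def)
  hence "(real n - 1) * S \<le> n * \<kappa>" using n by (simp add: t_def field_simps)
  hence "S \<le> n * \<kappa> / (real n - 1)" using n by (simp add: field_simps)
  also have "\<dots> = \<kappa> + \<kappa> * (1 / (real n - 1))" using n by (simp add: field_simps)
  also have "1 / (real n - 1) \<le> 2 / n" using n by (simp add: field_simps)
  hence "\<kappa> + \<kappa> * (1 / (real n - 1)) \<le> \<kappa> + \<kappa> * (2 / n)"
    using \<kappa>_nonneg by (intro add_left_mono mult_left_mono)
  also have "\<kappa> * (2 / n) = 2 * \<kappa> / n" by simp
  finally show ?thesis .
qed

section \<open>Second moments on a single coset\<close>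

definition row_sq :: "nat \<Rightarrow> real" where "row_sq i = (\<Sum>j\<in>V. (y i j)\<^sup>2)"
definition col_sq :: "nat \<Rightarrow> real" where "col_sq j = (\<Sum>i\<in>V. (y i j)\<^sup>2)"

lemma sum_submatrix:
  fixes b :: "nat \<Rightarrow> nat \<Rightarrow> real"
  assumes "i \<in> V" "j \<in> V"
  shows "(\<Sum>i'\<in>V - {i}. \<Sum>j'\<in>V - {j}. b i' j') =
    (\<Sum>i'\<in>V. \<Sum>j'\<in>V. b i' j') - (\<Sum>j'\<in>V. b i j') - (\<Sum>i'\<in>V. b i' j) + b i j"
  using assms by (simp add: sum_diff1 sum_subtractf)

text \<open>On the coset one cell is fixed and the rest is an arbitrary bijection between the other
  rows and columns, so \<open>sum_square_evaluation\<close> applies to the reduced matrix. As all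
  lines of \<open>y\<close> sum to zero, its row sums are \<open>- y i' j\<close>, its column sums
  \<open>- y i j'\<close> and its total \<open>y i j\<close>.\<close>

lemma sum_coset_g_square:
  assumes ij: "i \<in> V" "j \<in> V"
  shows "(\<Sum>\<sigma>\<in>coset i j. (g \<sigma> - y i j)\<^sup>2) =
    M / (real n - 1) * (S - row_sq i - col_sq j + (y i j)\<^sup>2) +
    M / ((real n - 1) * (real n - 2)) * (S - 2 * row_sq i - 2 * col_sq j + 4 * (y i j)\<^sup>2)"
proof -
  have "(\<Sum>\<sigma>\<in>coset i j. (g \<sigma> - y i j)\<^sup>2) = (\<Sum>\<sigma>\<in>coset i j. (\<Sum>i'\<in>V - {i}. y i' (\<sigma> i'))\<^sup>2)"
    using ij by (intro sum.cong refl) (auto simp: g_def sum_diff1)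
  also have "\<dots> = real (fact (n - 2)) * (\<Sum>i'\<in>V - {i}. \<Sum>j'\<in>V - {j}. (y i' j')\<^sup>2) +
     real (fact (n - 3)) * ((\<Sum>i'\<in>V - {i}. \<Sum>j'\<in>V - {j}. y i' j')\<^sup>2
       - (\<Sum>i'\<in>V - {i}. (\<Sum>j'\<in>V - {j}. y i' j')\<^sup>2) - (\<Sum>j'\<in>V - {j}. (\<Sum>i'\<in>V - {i}. y i' j')\<^sup>2)
       + (\<Sum>i'\<in>V - {i}. \<Sum>j'\<in>V - {j}. (y i' j')\<^sup>2))"
  proof (rule sum_square_evaluation)
    show "\<sigma> i' \<in> V - {j}" if "\<sigma> \<in> coset i j" "i' \<in> V - {i}" for \<sigma> i'
      using that Sym_V by (auto simp: Sym_inj)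
    show "card {\<sigma>\<in>coset i j. \<sigma> i' = j'} = fact (n - 2)" if "i' \<in> V - {i}" "j' \<in> V - {j}" for i' j'
      using card_two_cosets[of i n j i' j'] that ij by (simp add: V_def conj_assoc)
    show "card {\<sigma>\<in>coset i j. \<sigma> i' = j' \<and> \<sigma> i'' = j''} = fact (n - 3)"
      if "i' \<in> V - {i}" "j' \<in> V - {j}" "i'' \<in> V - {i}" "j'' \<in> V - {j}" "i' \<noteq> i''" "j' \<noteq> j''" for i' j' i'' j''
      using card_three_cosets[of i n j i' j' i'' j''] that ij by (simp add: V_def conj_assoc)
  qed (use Sym_inj_on in auto)
  also have "(\<Sum>i'\<in>V - {i}. \<Sum>j'\<in>V - {j}. (y i' j')\<^sup>2) = S - row_sq i - col_sq j + (y i j)\<^sup>2"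
    using ij by (simp add: sum_submatrix S_def row_sq_def col_sq_def)
  also have "(\<Sum>i'\<in>V - {i}. \<Sum>j'\<in>V - {j}. y i' j') = y i j"
    using ij by (simp add: sum_submatrix row_y col_y)
  also have "(\<Sum>i'\<in>V - {i}. (\<Sum>j'\<in>V - {j}. y i' j')\<^sup>2) = col_sq j - (y i j)\<^sup>2"
    using ij by (simp add: sum_diff1 row_y col_sq_def)
  also have "(\<Sum>j'\<in>V - {j}. (\<Sum>i'\<in>V - {i}. y i' j')\<^sup>2) = row_sq i - (y i j)\<^sup>2"
    using ij by (simp add: sum_diff1 col_y row_sq_def)
  also have "(y i j)\<^sup>2 - (col_sq j - (y i j)\<^sup>2) - (row_sq i - (y i j)\<^sup>2) + (S - row_sq i - col_sq j + (y i j)\<^sup>2)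
      = S - 2 * row_sq i - 2 * col_sq j + 4 * (y i j)\<^sup>2"
    by simp
  finally show ?thesis by (simp only: fact_n2 fact_n3)
qed

lemma y_sq_le: "i \<in> V \<Longrightarrow> j \<in> V \<Longrightarrow> (y i j)\<^sup>2 \<le> row_sq i"
  "i \<in> V \<Longrightarrow> j \<in> V \<Longrightarrow> (y i j)\<^sup>2 \<le> col_sq j"
  unfolding row_sq_def col_sq_def
  by (rule member_le_sum[where f = "\<lambda>j. (y i j)\<^sup>2"]; simp) (rule member_le_sum[where f = "\<lambda>i. (y i j)\<^sup>2"]; simp)

text \<open>The square of an entry is at most the square sum of its row and that of its column, so
  the corrections to \<open>S\<close> are nonpositive in both terms.\<close>

lemma sum_coset_g_square_le:
  assumes ij: "i \<in> V" "j \<in> V"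
  shows "(\<Sum>\<sigma>\<in>coset i j. (g \<sigma> - y i j)\<^sup>2) \<le> M / (real n - 2) * S"
proof -
  have nn: "row_sq i \<ge> 0" "col_sq j \<ge> 0" unfolding row_sq_def col_sq_def by (intro sum_nonneg; simp)+
  have "(\<Sum>\<sigma>\<in>coset i j. (g \<sigma> - y i j)\<^sup>2) \<le>
      M / (real n - 1) * S + M / ((real n - 1) * (real n - 2)) * S"
    unfolding sum_coset_g_square[OF ij] using y_sq_le[OF ij] M_pos n nn
    by (intro add_mono mult_left_mono) auto
  also have "\<dots> = M / (real n - 2) * S" using n by (simp add: divide_simps) (simp add: algebra_simps)
  finally show ?thesis .
qed

section \<open>Third-order sums and the lower bound for \<open>Z\<close>\<close>

definition cubes :: real where "cubes = (\<Sum>i\<in>V. \<Sum>j\<in>V. (y i j)^3)"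
definition Z :: real where "Z = (\<Sum>i\<in>V. \<Sum>j\<in>V. (y i j)\<^sup>2 * x i j)"

text \<open>After weighting with \<open>y\<close>, the terms depending on \<open>i\<close> alone or
  on \<open>j\<close> alone cancel because the lines of \<open>y\<close> sum to zero. Only cubes
  survive, with a coefficient of order \<open>M / n\<close>.\<close>

lemma sum_y_coset_g_square:
  "(\<Sum>i\<in>V. \<Sum>j\<in>V. y i j * (\<Sum>\<sigma>\<in>coset i j. (g \<sigma> - y i j)\<^sup>2)) =
    M * (real n + 2) / ((real n - 1) * (real n - 2)) * cubes"
proof -
  let ?a = "M / (real n - 1)" and ?b = "M / ((real n - 1) * (real n - 2))"
  have "(\<Sum>j\<in>V. y i j * (\<Sum>\<sigma>\<in>coset i j. (g \<sigma> - y i j)\<^sup>2)) =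
      (?a + 4 * ?b) * (\<Sum>j\<in>V. (y i j)^3) - (?a + 2 * ?b) * (\<Sum>j\<in>V. y i j * col_sq j)" if "i \<in> V" for i
  proof -
    have "(\<Sum>j\<in>V. y i j * (\<Sum>\<sigma>\<in>coset i j. (g \<sigma> - y i j)\<^sup>2)) =
        (\<Sum>j\<in>V. (?a * (S - row_sq i) + ?b * (S - 2 * row_sq i)) * y i j
           + (?a + 4 * ?b) * (y i j)^3 - (?a + 2 * ?b) * (y i j * col_sq j))"
    proof (intro sum.cong refl)
      fix j assume "j \<in> V"
      have "(\<Sum>\<sigma>\<in>coset i j. (g \<sigma> - y i j)\<^sup>2) = ?a * (S - row_sq i - col_sq j + (y i j)\<^sup>2) +
          ?b * (S - 2 * row_sq i - 2 * col_sq j + 4 * (y i j)\<^sup>2)"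
        by (rule sum_coset_g_square[OF that \<open>j \<in> V\<close>])
      moreover have "y i j * (a * (S - row_sq i - col_sq j + (y i j)\<^sup>2) +
          b * (S - 2 * row_sq i - 2 * col_sq j + 4 * (y i j)\<^sup>2)) =
          (a * (S - row_sq i) + b * (S - 2 * row_sq i)) * y i j
           + (a + 4 * b) * (y i j)^3 - (a + 2 * b) * (y i j * col_sq j)" for a b
        by (simp add: algebra_simps power2_eq_square power3_eq_cube)
      ultimately show "y i j * (\<Sum>\<sigma>\<in>coset i j. (g \<sigma> - y i j)\<^sup>2) =
          (?a * (S - row_sq i) + ?b * (S - 2 * row_sq i)) * y i j
           + (?a + 4 * ?b) * (y i j)^3 - (?a + 2 * ?b) * (y i j * col_sq j)"
        by (simp only:)
    qed
    also have "\<dots> = (?a * (S - row_sq i) + ?b * (S - 2 * row_sq i)) * (\<Sum>j\<in>V. y i j)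
       + (?a + 4 * ?b) * (\<Sum>j\<in>V. (y i j)^3) - (?a + 2 * ?b) * (\<Sum>j\<in>V. y i j * col_sq j)"
      by (simp only: sum.distrib sum_subtractf sum_distrib_left)
    finally show ?thesis by (simp add: row_y[OF that])
  qed
  hence "(\<Sum>i\<in>V. \<Sum>j\<in>V. y i j * (\<Sum>\<sigma>\<in>coset i j. (g \<sigma> - y i j)\<^sup>2)) =
     (\<Sum>i\<in>V. (?a + 4 * ?b) * (\<Sum>j\<in>V. (y i j)^3) - (?a + 2 * ?b) * (\<Sum>j\<in>V. y i j * col_sq j))"
    by (intro sum.cong refl) auto
  also have "\<dots> = (?a + 4 * ?b) * cubes - (?a + 2 * ?b) * (\<Sum>i\<in>V. \<Sum>j\<in>V. y i j * col_sq j)"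
    by (simp only: cubes_def sum_subtractf sum_distrib_left)
  also have "(\<Sum>i\<in>V. \<Sum>j\<in>V. y i j * col_sq j) = (\<Sum>j\<in>V. (\<Sum>i\<in>V. y i j) * col_sq j)"
    by (subst sum.swap) (simp add: sum_distrib_right)
  also have "\<dots> = 0" by (simp add: col_y)
  also have "?a + 4 * ?b = M * (real n + 2) / ((real n - 1) * (real n - 2))"
    using n by (simp add: divide_simps) (simp add: algebra_simps)
  finally show ?thesis by simp
qed

lemma cubes_le: "cubes \<le> S"
  unfolding cubes_def S_def
proof (intro sum_mono)
  fix i j assume "i \<in> V" "j \<in> V"
  hence "y i j \<le> 1" using abs_y_le_1[of i j] by auto
  hence "(y i j)\<^sup>2 * y i j \<le> (y i j)\<^sup>2 * 1" by (intro mult_left_mono) auto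
  thus "(y i j)^3 \<le> (y i j)\<^sup>2" by (simp add: power3_eq_cube power2_eq_square)
qed

lemma Z_nonneg: "Z \<ge> 0"
  unfolding Z_def using x_nonneg by (intro sum_nonneg) auto

text \<open>Cauchy-Schwarz over the pairs \<open>(i,\<sigma>)\<close>, where
  \<open>j = \<sigma> i\<close>. Each square of \<open>e\<close> is counted once per row, and this
  factor \<open>n\<close> is compensated by the divisor n - 2 in
  \<open>sum_coset_g_square_le\<close>.\<close>

lemma sum_e_g_coset_bound:
  "\<bar>\<Sum>i\<in>V. \<Sum>j\<in>V. y i j * (\<Sum>\<sigma>\<in>coset i j. e \<sigma> * (g \<sigma> - y i j))\<bar> \<le> 2 * M * S * sqrt \<rho>"
proof -
  have regroup: "(\<Sum>i\<in>V. \<Sum>j\<in>V. \<Sum>\<sigma>\<in>coset i j. w i j \<sigma>) = (\<Sum>(i,\<sigma>)\<in>V \<times> Sym n. w i (\<sigma> i) \<sigma>)"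
    for w :: "nat \<Rightarrow> nat \<Rightarrow> (nat \<Rightarrow> nat) \<Rightarrow> real"
  proof -
    have "(\<Sum>i\<in>V. \<Sum>j\<in>V. \<Sum>\<sigma>\<in>coset i j. w i j \<sigma>) = (\<Sum>i\<in>V. \<Sum>j\<in>V. \<Sum>\<sigma>\<in>coset i j. w i (\<sigma> i) \<sigma>)"
      by (intro sum.cong refl) auto
    also have "\<dots> = (\<Sum>i\<in>V. \<Sum>\<sigma>\<in>Sym n. w i (\<sigma> i) \<sigma>)"
      by (intro sum.cong refl sum_over_values)
    finally show ?thesis by (simp add: sum.cartesian_product)
  qed
  let ?H = "\<Sum>i\<in>V. \<Sum>j\<in>V. y i j * (\<Sum>\<sigma>\<in>coset i j. e \<sigma> * (g \<sigma> - y i j))"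
  have "?H = (\<Sum>i\<in>V. \<Sum>j\<in>V. \<Sum>\<sigma>\<in>coset i j. e \<sigma> * (y i j * (g \<sigma> - y i j)))"
    by (simp add: sum_distrib_left algebra_simps)
  also have "\<dots> = (\<Sum>p\<in>V \<times> Sym n. e (snd p) * (y (fst p) (snd p (fst p)) * (g (snd p) - y (fst p) (snd p (fst p)))))"
    by (simp add: regroup case_prod_beta)
  finally have eqH: "?H = \<dots>" .
  have "?H\<^sup>2 \<le> (\<Sum>p\<in>V \<times> Sym n. (e (snd p))\<^sup>2) *
      (\<Sum>p\<in>V \<times> Sym n. (y (fst p) (snd p (fst p)) * (g (snd p) - y (fst p) (snd p (fst p))))\<^sup>2)"
    by (subst eqH) (rule Cauchy_Schwarz_ineq_sum)
  also have "(\<Sum>p\<in>V \<times> Sym n. (e (snd p))\<^sup>2) = n * (M * \<rho>)"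
    using sum.cartesian_product[of "\<lambda>i \<sigma>. (e \<sigma>)\<^sup>2" "Sym n" V]
    by (simp add: case_prod_beta sum_e_square)
  also have "(\<Sum>p\<in>V \<times> Sym n. (y (fst p) (snd p (fst p)) * (g (snd p) - y (fst p) (snd p (fst p))))\<^sup>2)
     = (\<Sum>i\<in>V. \<Sum>j\<in>V. \<Sum>\<sigma>\<in>coset i j. (y i j * (g \<sigma> - y i j))\<^sup>2)"
    by (simp add: regroup case_prod_beta)
  also have "\<dots> = (\<Sum>i\<in>V. \<Sum>j\<in>V. (y i j)\<^sup>2 * (\<Sum>\<sigma>\<in>coset i j. (g \<sigma> - y i j)\<^sup>2))"
    by (simp add: power_mult_distrib sum_distrib_left)
  also have "n * (M * \<rho>) * \<dots> \<le> n * (M * \<rho>) * (\<Sum>i\<in>V. \<Sum>j\<in>V. (y i j)\<^sup>2 * (M / (real n - 2) * S))"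
    using M_pos \<rho>_nonneg by (intro mult_left_mono sum_mono sum_coset_g_square_le) auto
  also have "(\<Sum>i\<in>V. \<Sum>j\<in>V. (y i j)\<^sup>2 * (M / (real n - 2) * S)) = S * (M / (real n - 2) * S)"
  proof -
    have "(\<Sum>i\<in>V. \<Sum>j\<in>V. (y i j)\<^sup>2 * c) = S * c" for c
      unfolding S_def by (simp add: sum_distrib_right)
    thus ?thesis .
  qed
  also have "n * (M * \<rho>) * \<dots> = real n / (real n - 2) * (M\<^sup>2 * S\<^sup>2 * \<rho>)"
    by (simp add: power2_eq_square)
  also have "\<dots> \<le> 4 * (M\<^sup>2 * S\<^sup>2 * \<rho>)"
    using n \<rho>_nonneg by (intro mult_right_mono) (auto simp: field_simps)
  also have "\<dots> = (2 * M * S * sqrt \<rho>)\<^sup>2"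
    using \<rho>_nonneg by (simp add: power_mult_distrib)
  finally have "\<bar>?H\<bar> \<le> \<bar>2 * M * S * sqrt \<rho>\<bar>" by (simp only: abs_le_square_iff)
  also have "\<dots> = 2 * M * S * sqrt \<rho>" using M_pos S_nonneg \<rho>_nonneg by (intro abs_of_nonneg) simp
  finally show ?thesis .
qed

text \<open>On the coset, \<open>h\<close> splits into the fixed part
  \<open>\<alpha> + t * y i j\<close> and the fluctuation \<open>t * (g \<sigma> - y i j)\<close>.
  In the product of \<open>f\<close> with the fluctuation, \<open>f\<close> is replaced by
  \<open>h + e\<close>; this leaves moments of the fluctuation and an error term with
  \<open>e\<close>.\<close>

lemma sum_f_h_coset:
  assumes ij: "i \<in> V" "j \<in> V"
  shows "(\<Sum>\<sigma>\<in>coset i j. f \<sigma> * h \<sigma>) = M * x i j * (\<alpha> + t * y i j) +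
    t * ((\<alpha> + t * y i j) * (M / (real n - 1) * y i j) + t * (\<Sum>\<sigma>\<in>coset i j. (g \<sigma> - y i j)\<^sup>2)
       + (\<Sum>\<sigma>\<in>coset i j. e \<sigma> * (g \<sigma> - y i j)))"
proof -
  have "f \<sigma> * h \<sigma> = (\<alpha> + t * y i j) * f \<sigma> + t * ((\<alpha> + t * y i j) * (g \<sigma> - y i j)
     + t * (g \<sigma> - y i j)\<^sup>2 + e \<sigma> * (g \<sigma> - y i j))" for \<sigma>
    by (simp add: e_def h_def algebra_simps power2_eq_square)
  hence "(\<Sum>\<sigma>\<in>coset i j. f \<sigma> * h \<sigma>) = (\<alpha> + t * y i j) * (\<Sum>\<sigma>\<in>coset i j. f \<sigma>)
     + t * ((\<alpha> + t * y i j) * (\<Sum>\<sigma>\<in>coset i j. g \<sigma> - y i j)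
     + t * (\<Sum>\<sigma>\<in>coset i j. (g \<sigma> - y i j)\<^sup>2) + (\<Sum>\<sigma>\<in>coset i j. e \<sigma> * (g \<sigma> - y i j)))"
    by (simp add: sum.distrib sum_distrib_left[symmetric])
  also have "(\<Sum>\<sigma>\<in>coset i j. g \<sigma> - y i j) = M * (real n / (real n - 1)) * y i j - M * y i j"
    using card_coset[OF ij] sum_g_coset[OF ij] by (simp add: sum_subtractf M_def)
  also have "\<dots> = M / (real n - 1) * y i j" using n by (simp add: field_simps)
  finally show ?thesis by (simp add: sum_f_coset algebra_simps)
qed

text \<open>The factor \<open>g\<close> is expanded over the cosets by
  \<open>sum_g_weighted\<close>. The main term is \<open>\<alpha> * S + t * Z\<close>; the
  fluctuations carry factors of order 1/n, and \<open>e\<close> contributes the term with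
  \<open>sqrt \<rho>\<close>.\<close>

lemma sum_f_h_g:
  "(\<Sum>\<sigma>\<in>Sym n. f \<sigma> * h \<sigma> * g \<sigma>) \<le> M * (\<alpha> * S + t * Z) +
    t * (M / (real n - 1) * (\<alpha> * S + t * cubes)
      + t * (M * (real n + 2) / ((real n - 1) * (real n - 2)) * cubes) + 2 * M * S * sqrt \<rho>)"
proof -
  let ?G = "\<lambda>i j. \<Sum>\<sigma>\<in>coset i j. (g \<sigma> - y i j)\<^sup>2"
  let ?H = "\<lambda>i j. \<Sum>\<sigma>\<in>coset i j. e \<sigma> * (g \<sigma> - y i j)"
  have "(\<Sum>\<sigma>\<in>Sym n. f \<sigma> * h \<sigma> * g \<sigma>) = (\<Sum>i\<in>V. \<Sum>j\<in>V. y i j * (\<Sum>\<sigma>\<in>coset i j. f \<sigma> * h \<sigma>))"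
    by (rule sum_g_weighted)
  also have "\<dots> = (\<Sum>i\<in>V. \<Sum>j\<in>V. M * (\<alpha> * (y i j * x i j) + t * ((y i j)\<^sup>2 * x i j)) +
      t * (M / (real n - 1) * (\<alpha> * (y i j)\<^sup>2 + t * (y i j)^3) + t * (y i j * ?G i j) + y i j * ?H i j))"
  proof -
    have "y * (M * x * (\<alpha> + t * y) + t * ((\<alpha> + t * y) * (m * y) + t * G + H)) =
        M * (\<alpha> * (y * x) + t * (y\<^sup>2 * x)) + t * (m * (\<alpha> * y\<^sup>2 + t * y^3) + t * (y * G) + y * H)"
      for x y m G H :: real
      by (simp add: algebra_simps power2_eq_square power3_eq_cube)
    thus ?thesis by (intro sum.cong refl) (simp only: sum_f_h_coset)
  qed
  also have "\<dots> = M * (\<alpha> * S + t * Z) +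
      t * (M / (real n - 1) * (\<alpha> * S + t * cubes)
      + t * (\<Sum>i\<in>V. \<Sum>j\<in>V. y i j * ?G i j) + (\<Sum>i\<in>V. \<Sum>j\<in>V. y i j * ?H i j))"
    by (simp only: sum.distrib sum_distrib_left[symmetric] sum_y_x Z_def[symmetric] cubes_def[symmetric] S_def[symmetric])
  also have "(\<Sum>i\<in>V. \<Sum>j\<in>V. y i j * ?G i j) = M * (real n + 2) / ((real n - 1) * (real n - 2)) * cubes"
    by (rule sum_y_coset_g_square)
  also have "(\<Sum>i\<in>V. \<Sum>j\<in>V. y i j * ?H i j) \<le> 2 * M * S * sqrt \<rho>"
    using sum_e_g_coset_bound by linarith
  finally show ?thesis using t_bounds by (simp add: mult_left_mono)
qed

text \<open>On \<open>F\<close> one has h = 1 - e, and the square of 1 - e is at least 1 -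
  2e.\<close>

lemma sum_f_h_square: "M * (\<kappa> - 2 * \<rho>) \<le> (\<Sum>\<sigma>\<in>Sym n. f \<sigma> * h \<sigma> * h \<sigma>)"
proof -
  have "f \<sigma> - 2 * (f \<sigma> * e \<sigma>) \<le> f \<sigma> * h \<sigma> * h \<sigma>" for \<sigma>
    using zero_le_power2[of "1 - h \<sigma>"]
    by (cases "\<sigma> \<in> F") (simp_all add: f_def e_def algebra_simps power2_eq_square)
  hence le: "(\<Sum>\<sigma>\<in>Sym n. f \<sigma> - 2 * (f \<sigma> * e \<sigma>)) \<le> (\<Sum>\<sigma>\<in>Sym n. f \<sigma> * h \<sigma> * h \<sigma>)"
    by (intro sum_mono)
  have "(\<Sum>\<sigma>\<in>Sym n. f \<sigma> - 2 * (f \<sigma> * e \<sigma>)) = M * \<kappa> - 2 * (M * \<rho>)"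
    by (simp only: sum_subtractf sum_distrib_left[symmetric] sum_f sum_f_e)
  with le show ?thesis by (simp add: algebra_simps)
qed

text \<open>The sum of \<open>f * h * h\<close> is bounded below by \<open>sum_f_h_square\<close>
  and, after expanding one factor \<open>h\<close>, above by \<open>sum_f_h\<close> and
  \<open>sum_f_h_g\<close>. Dividing by \<open>M\<close> isolates \<open>Z\<close>.\<close>

lemma Z_ge: "\<kappa> - 2 * \<rho> - \<alpha> * \<kappa> - 2 * \<alpha> * S - 8 * S / n - 2 * S * sqrt \<rho> \<le> Z"
proof -
  let ?c = "(real n + 2) / ((real n - 1) * (real n - 2))"
  have "(\<Sum>\<sigma>\<in>Sym n. f \<sigma> * h \<sigma> * h \<sigma>) = \<alpha> * (\<Sum>\<sigma>\<in>Sym n. f \<sigma> * h \<sigma>) + t * (\<Sum>\<sigma>\<in>Sym n. f \<sigma> * h \<sigma> * g \<sigma>)"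
    unfolding sum_distrib_left sum.distrib[symmetric] by (intro sum.cong refl) (simp add: h_def algebra_simps)
  hence "M * (\<kappa> - 2 * \<rho>) \<le> \<alpha> * (M * (\<kappa> - \<rho>)) + t * (M * (\<alpha> * S + t * Z) +
    t * (M / (real n - 1) * (\<alpha> * S + t * cubes) + t * (M * (real n + 2) / ((real n - 1) * (real n - 2)) * cubes)
      + 2 * M * S * sqrt \<rho>))"
    using sum_f_h_square mult_left_mono[OF sum_f_h_g, of t] t_bounds unfolding sum_f_h by linarith
  also have "\<dots> = M * (\<alpha> * (\<kappa> - \<rho>) + t * (\<alpha> * S + t * Z + t * (1 / (real n - 1) * (\<alpha> * S + t * cubes)
      + t * (?c * cubes) + 2 * S * sqrt \<rho>)))"
    by (simp add: algebra_simps)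
  finally have main: "\<kappa> - 2 * \<rho> \<le> \<alpha> * (\<kappa> - \<rho>) + t * (\<alpha> * S + t * Z + t * (1 / (real n - 1) * (\<alpha> * S + t * cubes)
      + t * (?c * cubes) + 2 * S * sqrt \<rho>))"
    using M_pos by simp
  have scale: "t * a \<le> b" if "a \<le> b" "0 \<le> b" for a b
    using that t_bounds mult_left_le_one_le[of b t] mult_left_mono[of a b t] by linarith
  have n1: "1 / (real n - 1) \<le> 2 / n" using n by (simp add: field_simps)
  have c: "?c \<le> 6 / n" proof -
    have "real n * (real n + 2) \<le> 6 * ((real n - 1) * (real n - 2))"
    proof -
      have "real n * 4 \<le> real n * real n" using n by (intro mult_left_mono) auto
      thus ?thesis by (simp add: algebra_simps)
    qed
    moreover have "(real n - 1) * (real n - 2) > 0" "real n > 0" using n by auto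
    ultimately show ?thesis by (simp add: pos_divide_le_eq pos_le_divide_eq mult.commute)
  qed
  have c0: "?c \<ge> 0" "1 / (real n - 1) \<ge> 0" using n by auto
  have nn: "\<alpha> * S \<ge> 0" "S \<ge> 0" "Z \<ge> 0" "S * sqrt \<rho> \<ge> 0" using \<alpha>_bounds S_nonneg Z_nonneg \<rho>_nonneg by auto
  have aS: "\<alpha> * S \<le> S" using \<alpha>_bounds S_nonneg by (simp add: mult_left_le_one_le)
  have "t * cubes \<le> S" by (rule scale[OF cubes_le S_nonneg])
  hence "1 / (real n - 1) * (\<alpha> * S + t * cubes) \<le> 1 / (real n - 1) * (\<alpha> * S + S)"
    using c0 by (intro mult_left_mono) auto
  also have "\<dots> \<le> \<alpha> * S + 2 * S / n"
  proof -
    have "1 / (real n - 1) * (\<alpha> * S) \<le> 1 * (\<alpha> * S)" using n nn by (intro mult_right_mono) auto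
    moreover have "1 / (real n - 1) * S \<le> 2 / n * S" using n1 nn by (intro mult_right_mono) auto
    ultimately show ?thesis by (simp add: algebra_simps)
  qed
  finally have 1: "1 / (real n - 1) * (\<alpha> * S + t * cubes) \<le> \<alpha> * S + 2 * S / n" .
  have "?c * cubes \<le> ?c * S" using c0 cubes_le by (intro mult_left_mono)
  also have "\<dots> \<le> 6 / n * S" using c nn by (intro mult_right_mono)
  finally have 2: "t * (?c * cubes) \<le> 6 * S / n" using nn by (intro scale) auto
  have "t * (1 / (real n - 1) * (\<alpha> * S + t * cubes) + t * (?c * cubes) + 2 * S * sqrt \<rho>)
      \<le> \<alpha> * S + 2 * S / n + 6 * S / n + 2 * S * sqrt \<rho>"
    by (rule scale) (use 1 2 nn in \<open>simp_all add: add_nonneg_nonneg\<close>)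
  moreover have "t * Z \<le> Z" using nn by (intro scale) auto
  ultimately have "t * (\<alpha> * S + t * Z + t * (1 / (real n - 1) * (\<alpha> * S + t * cubes)
      + t * (?c * cubes) + 2 * S * sqrt \<rho>)) \<le> \<alpha> * S + Z + (\<alpha> * S + 2 * S / n + 6 * S / n + 2 * S * sqrt \<rho>)"
  proof (intro scale)
    have "2 * S / n \<ge> 0" "6 * S / n \<ge> 0" using nn by auto
    thus "0 \<le> \<alpha> * S + Z + (\<alpha> * S + 2 * S / n + 6 * S / n + 2 * S * sqrt \<rho>)"
      using nn by linarith
  qed linarith
  moreover have "\<alpha> * (\<kappa> - \<rho>) \<le> \<alpha> * \<kappa>" using \<alpha>_bounds \<rho>_nonneg by (intro mult_left_mono) auto
  moreover have "8 * S / n = 2 * S / n + 6 * S / n" by (simp add: field_simps)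
  ultimately show ?thesis using main by linarith
qed

text \<open>Equal to \<open>S - Z\<close>. A summand vanishes only if the density is \<alpha> or 1,
  so a small value makes the densities nearly two-valued.\<close>

definition deviation :: real where "deviation = (\<Sum>i\<in>V. \<Sum>j\<in>V. (y i j)\<^sup>2 * (1 - x i j))"

text \<open>From \<open>\<kappa> \<ge> 1/2\<close> follows
  \<open>\<kappa> / n \<le> 2 * (\<alpha> * \<kappa>)\<close>. The constant is 41 = 4 + 1 + 4 + 32,
  contributed by \<open>S - \<kappa>\<close>, \<open>\<alpha> * \<kappa>\<close>,
  \<open>2 * (\<alpha> * S)\<close> and \<open>8 * S / n\<close>.\<close>

lemma deviation_le:
  assumes "\<kappa> \<ge> 1/2"
  shows "deviation \<le> 2 * \<rho> + 4 * \<kappa> * sqrt \<rho> + 41 * (\<alpha> * \<kappa>)"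
proof -
  have "deviation = S - Z"
    by (simp add: deviation_def S_def Z_def right_diff_distrib sum_subtractf)
  hence "deviation \<le> (S - \<kappa>) + 2 * \<rho> + \<alpha> * \<kappa> + 2 * (\<alpha> * S) + 8 * S / n + 2 * (S * sqrt \<rho>)"
    using Z_ge by simp
  moreover have "\<kappa> * 1 \<le> \<kappa> * (2 * \<kappa>)" using assms by (intro mult_left_mono) auto
  hence \<kappa>n: "\<kappa> / n \<le> 2 * (\<alpha> * \<kappa>)"
    using divide_right_mono[of \<kappa> "2 * \<kappa> * \<kappa>" "real n"] by (simp add: \<alpha>_def)
  have "\<kappa> * (2 / n) \<le> \<kappa> * 1" using n assms by (intro mult_left_mono) auto
  hence "2 * \<kappa> / n \<le> \<kappa>" by (simp add: mult.commute)
  hence S2: "S \<le> 2 * \<kappa>" using S_le by linarith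
  have "\<alpha> * S \<le> \<alpha> * (2 * \<kappa>)" "S * sqrt \<rho> \<le> 2 * \<kappa> * sqrt \<rho>" "8 * S / n \<le> 8 * (2 * \<kappa>) / n"
    using S2 \<alpha>_bounds \<rho>_nonneg by (auto intro!: mult_left_mono mult_right_mono divide_right_mono)
  moreover have "S - \<kappa> \<le> 2 * (\<kappa> / n)" "8 * (2 * \<kappa>) / n = 16 * (\<kappa> / n)" using S_le by auto
  ultimately show ?thesis using \<kappa>n by linarith
qed

subsection \<open>Comparison with the extremal family\<close>

text \<open>Cauchy--Schwarz in every column outside row \<open>u\<close>; it is sharp for a union of cosets with first index \<open>u\<close>.\<close>

lemma t_S_ge:
  assumes u: "u \<in> V"
  shows "(\<Sum>j\<in>V. (x u j)\<^sup>2) - \<alpha> * \<kappa> \<le> t * S"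
proof -
  have n1: "real n - 1 > 0" using n by simp
  have col: "(real n - 1) * (x u j)\<^sup>2 + (\<kappa> - x u j)\<^sup>2 \<le> (real n - 1) * (\<Sum>i\<in>V. (x i j)\<^sup>2)" if "j \<in> V" for j
  proof -
    have "\<kappa> - x u j = (\<Sum>i\<in>V - {u}. x i j)" using col_x[OF that] u by (simp add: sum_diff1)
    hence "(\<kappa> - x u j)\<^sup>2 \<le> (\<Sum>i\<in>V - {u}. (x i j)\<^sup>2) * real (card (V - {u}))"
      by (simp only: sum_squared_le_sum_of_squares)
    also have "real (card (V - {u})) = real n - 1" using u n by (simp add: of_nat_diff)
    also have "(\<Sum>i\<in>V - {u}. (x i j)\<^sup>2) = (\<Sum>i\<in>V. (x i j)\<^sup>2) - (x u j)\<^sup>2" using u by (simp add: sum_diff1)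
    finally show ?thesis by (simp add: algebra_simps)
  qed
  let ?a = "\<Sum>j\<in>V. (x u j)\<^sup>2"
  have "(\<Sum>j\<in>V. (real n - 1) * (x u j)\<^sup>2 + (\<kappa> - x u j)\<^sup>2) = (\<Sum>j\<in>V. real n * (x u j)\<^sup>2 - 2 * \<kappa> * x u j + \<kappa>\<^sup>2)"
    by (intro sum.cong refl) (simp add: algebra_simps power2_eq_square)
  also have "\<dots> = real n * ?a - 2 * \<kappa> * (\<Sum>j\<in>V. x u j) + n * \<kappa>\<^sup>2"
    by (simp add: sum.distrib sum_subtractf sum_distrib_left)
  also have "\<dots> = real n * ?a - 2 * \<kappa>\<^sup>2 + n * \<kappa>\<^sup>2"
    using row_x[OF u] by (simp add: power2_eq_square)
  finally have eq: "(\<Sum>j\<in>V. (real n - 1) * (x u j)\<^sup>2 + (\<kappa> - x u j)\<^sup>2) = \<dots>" .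
  have "real n * ?a - 2 * \<kappa>\<^sup>2 + n * \<kappa>\<^sup>2 \<le> (\<Sum>j\<in>V. (real n - 1) * (\<Sum>i\<in>V. (x i j)\<^sup>2))"
    unfolding eq[symmetric] by (intro sum_mono col)
  also have "\<dots> = (real n - 1) * (S + \<kappa>\<^sup>2)"
    unfolding sum_x_squares[symmetric] by (subst sum.swap) (simp add: sum_distrib_left)
  finally have "real n * ?a - \<kappa>\<^sup>2 \<le> (real n - 1) * S" by (simp add: algebra_simps)
  hence "(real n * ?a - \<kappa>\<^sup>2) / n \<le> (real n - 1) * S / n" by (rule divide_right_mono) simp
  moreover have "(real n * ?a - \<kappa>\<^sup>2) / n = ?a - \<alpha> * \<kappa>"
    using n by (simp add: diff_divide_distrib \<alpha>_def power2_eq_square)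
  moreover have "(real n - 1) * S / n = t * S" using n by (simp add: t_def of_nat_diff)
  ultimately show ?thesis by simp
qed

end

section \<open>The maximum over families of coset form\<close>

lemma one_coset_alt: "one_coset n i j = {\<sigma>\<in>Sym n. \<sigma> i = j}"
  by (simp add: one_coset_def)

lemma finite_one_coset [simp]: "finite (one_coset n i j)"
  by (simp add: one_coset_alt)

lemma card_one_coset': "i \<in> {1..n} \<Longrightarrow> j \<in> {1..n} \<Longrightarrow> card (one_coset n i j) = fact (n - 1)"
  unfolding one_coset_alt by (rule card_one_coset)

lemma coset_form_subset: "coset_form n s F \<Longrightarrow> F \<subseteq> Sym n"
  unfolding coset_form_def one_cosets_def one_coset_def by blast

text \<open>A crude bound that guarantees that the \<open>ARG_MAX\<close> in
  \<open>extremal_family\<close> is attained.\<close>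

lemma total_intersection_le:
  assumes "F \<subseteq> Sym n"
  shows "total_intersection n F \<le> fact n * (fact n * n)"
proof -
  have "card F \<le> fact n" using card_mono[OF finite_Sym assms] by (simp add: card_Sym)
  have "card {i\<in>{1..n}. A i = B i} \<le> n" for A B :: "nat \<Rightarrow> nat"
    by (rule order.trans[OF card_mono[of "{1..n}"]]) auto
  hence "total_intersection n F \<le> (\<Sum>A\<in>F. \<Sum>B\<in>F. n)"
    unfolding total_intersection_def by (intro sum_mono)
  also have "\<dots> = card F * (card F * n)" by simp
  also have "\<dots> \<le> fact n * (fact n * n)"
    using \<open>card F \<le> fact n\<close> by (intro mult_mono) auto
  finally show ?thesis .
qed

lemma extremal_family_ge:
  assumes "s > 0" "coset_form n s F"
  shows "total_intersection n F \<le> total_intersection n (extremal_family n s)"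
proof -
  have "\<forall>F. coset_form n s F \<longrightarrow> total_intersection n F < Suc (fact n * (fact n * n))"
    using total_intersection_le coset_form_subset by (meson le_imp_less_Suc)
  from arg_max_nat_le[of "coset_form n s" F, OF assms(2) this] show ?thesis
    using assms(1) by (simp add: extremal_family_def)
qed

text \<open>The competitor uses only cosets with first index 1, which are disjoint. From
  \<open>s < fact n\<close> follows \<open>q < n\<close>, so the value \<open>Suc q\<close> is
  available for the leftover part.\<close>

lemma ex_coset_form_in_first_row:
  fixes n s :: nat
  defines "q \<equiv> s div fact (n - 1)"
  assumes n: "n \<ge> 2" and s: "s < fact n"
  obtains F where "coset_form n s F" "card F = s"
    "\<And>j. j \<in> {1..q} \<Longrightarrow> {\<sigma>\<in>F. \<sigma> 1 = j} = one_coset n 1 j"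
    "card {\<sigma>\<in>F. \<sigma> 1 = Suc q} = s mod fact (n - 1)" "q < n"
proof -
  have "(fact n :: nat) = n * fact (n - 1)" using n by (subst fact_reduce) auto
  hence q: "q < n" using s unfolding q_def by (simp add: less_mult_imp_div_less)
  have one: "1 \<in> {1..n}" and Suc_q: "Suc q \<in> {1..n}" using n q by auto
  have "s mod fact (n - 1) \<le> card (one_coset n 1 (Suc q))"
    using card_one_coset'[OF one Suc_q] by (simp add: less_imp_le)
  then obtain R where R: "R \<subseteq> one_coset n 1 (Suc q)" "card R = s mod fact (n - 1)"
    by (meson obtain_subset_with_card_n)
  define P where "P = one_coset n 1 ` {1..q}"
  have disj: "disjnt (one_coset n 1 j) (one_coset n 1 j')" if "j \<noteq> j'" for j j'
    using that by (auto simp: disjnt_def one_coset_alt)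
  have ne: "one_coset n 1 j \<noteq> {}" if "j \<in> {1..n}" for j
    using card_one_coset'[OF one that] by (metis card.empty fact_nonzero)
  \<comment> \<open>Disjoint cosets are distinct because they are nonempty; this yields
    \<open>card P = q\<close>.\<close>
  have inj: "inj_on (one_coset n 1) {1..q}"
  proof (rule inj_onI)
    fix j j' assume "j \<in> {1..q}" "j' \<in> {1..q}" "one_coset n 1 j = one_coset n 1 j'"
    thus "j = j'" using disj[of j j'] ne[of j] q by (auto simp: disjnt_def)
  qed
  have fin: "finite R" using R(1) by (rule finite_subset) simp
  have disjR: "\<Union>P \<inter> R = {}"
    using R(1) by (auto simp: P_def one_coset_alt)
  have "coset_form n s (\<Union>P \<union> R)"
    unfolding coset_form_def
  proof (intro exI[of _ P] exI[of _ R] conjI refl)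
    have "{1..q} \<subseteq> {1..n}" using q by auto
    thus "P \<subseteq> one_cosets n" using one unfolding P_def one_cosets_def by blast
    show "card P = s div fact (n - 1)" using card_image[OF inj] by (simp add: P_def q_def)
    show "pairwise disjnt P"
      unfolding pairwise_def
    proof (intro ballI impI)
      fix C C' assume "C \<in> P" "C' \<in> P" "C \<noteq> C'"
      then obtain j j' where "C = one_coset n 1 j" "C' = one_coset n 1 j'" "j \<noteq> j'"
        unfolding P_def by blast
      thus "disjnt C C'" using disj by simp
    qed
    show "card R = s - (s div fact (n - 1)) * fact (n - 1)"
      unfolding R(2) by (rule minus_div_mult_eq_mod[symmetric])
    have "\<forall>C\<in>P. disjnt (one_coset n 1 (Suc q)) C" unfolding P_def using disj by auto
    moreover have "one_coset n 1 (Suc q) \<in> one_cosets n" using one Suc_q unfolding one_cosets_def by blast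
    ultimately show "R = {} \<or> (\<exists>D \<in> one_cosets n. (\<forall>C\<in>P. disjnt D C) \<and> R \<subseteq> D)" using R(1) by blast
  qed
  moreover have "card (\<Union>P \<union> R) = s"
  proof -
    have "card (\<Union>P) = (\<Sum>j\<in>{1..q}. card (one_coset n 1 j))"
      unfolding P_def
      by (rule card_UN_disjoint) (use disj in \<open>simp_all add: disjnt_def del: One_nat_def\<close>)
    also have "\<dots> = (\<Sum>j\<in>{1..q}. fact (n - 1))"
      using q by (intro sum.cong refl card_one_coset'[OF one]) simp
    finally have "card (\<Union>P) = q * fact (n - 1)" by simp
    moreover have "finite (\<Union>P)" by (auto simp: P_def)
    ultimately show ?thesis using fin disjR by (simp add: card_Un_disjoint R(2) q_def)
  qed
  moreover have "{\<sigma>\<in>\<Union>P \<union> R. \<sigma> 1 = j} = one_coset n 1 j" if "j \<in> {1..q}" for j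
    using that R(1) by (auto simp: P_def one_coset_alt)
  moreover have "{\<sigma>\<in>\<Union>P \<union> R. \<sigma> 1 = Suc q} = R"
    using R(1) by (auto simp: P_def one_coset_alt)
  ultimately show thesis using that[of "\<Union>P \<union> R"] R(2) q by simp
qed

context permutation_family begin

text \<open>The competitor has the size of \<open>F\<close>, hence the same \<kappa> and \<alpha>,
  and its first row of densities contains \<open>q\<close> ones and one entry \<theta>. Its own
  \<open>S\<close>, bounded by \<open>t_S_ge\<close>, serves as \<open>S'\<close>.\<close>

lemma total_intersection_extremal_ge:
  fixes q :: nat and \<theta> :: real
  assumes pos: "card F > 0" and lt: "card F < fact n"
  defines "q \<equiv> card F div fact (n - 1)"
  defines "\<theta> \<equiv> \<kappa> - q"
  shows "0 \<le> \<theta>" "\<theta> < 1"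
    "\<exists>S'. real (total_intersection n (extremal_family n (card F))) \<ge> M\<^sup>2 * (S' + \<kappa>\<^sup>2) \<and>
       q + \<theta>\<^sup>2 - \<alpha> * \<kappa> \<le> t * S'"
proof -
  let ?s = "card F" and ?m = "fact (n - 1) :: nat"
  have "real ?s = q * M + real (?s mod ?m)"
    unfolding q_def M_def by (metis div_mult_mod_eq of_nat_add of_nat_fact of_nat_mult)
  hence \<theta>: "\<theta> = real (?s mod ?m) / M" using M_pos by (simp add: \<theta>_def \<kappa>_def field_simps)
  have "real (?s mod ?m) < real ?m" by (intro of_nat_mono less_imp_of_nat_less) simp
  hence "real (?s mod ?m) < M" by (simp add: M_def)
  thus "0 \<le> \<theta>" "\<theta> < 1" using M_pos by (simp_all add: \<theta>)
  have n2: "n \<ge> 2" using n by simp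
  obtain F0 where F0: "coset_form n ?s F0" "card F0 = ?s"
    "\<And>j. j \<in> {1..q} \<Longrightarrow> {\<sigma>\<in>F0. \<sigma> 1 = j} = one_coset n 1 j"
    "card {\<sigma>\<in>F0. \<sigma> 1 = Suc q} = ?s mod ?m" "q < n"
    using ex_coset_form_in_first_row[OF n2 lt] unfolding q_def by blast
  interpret F0: permutation_family n F0
    by (rule permutation_family.intro[OF n coset_form_subset[OF F0(1)]])
  have same: "F0.\<kappa> = \<kappa>" "F0.\<alpha> = \<alpha>"
    by (simp_all add: F0.\<kappa>_def \<kappa>_def F0(2) F0.\<alpha>_def \<alpha>_def)
  have one: "1 \<in> V" using n by (simp add: V_def)
  have x1: "F0.x 1 j = 1" if "j \<in> {1..q}" for j
  proof -
    have "j \<in> {1..n}" "1 \<in> {1..n}" using that F0(5) n by auto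
    hence "real (card {\<sigma>\<in>F0. \<sigma> 1 = j}) = M" unfolding F0(3)[OF that] by (simp add: card_one_coset' M_def)
    thus ?thesis using M_pos by (simp add: F0.x_def)
  qed
  have x2: "F0.x 1 (Suc q) = \<theta>" by (simp only: F0.x_def F0(4) \<theta>)
  have "(\<Sum>j\<in>{1..q}. (F0.x 1 j)\<^sup>2) = (\<Sum>j\<in>{1..q}. 1)"
    by (intro sum.cong refl) (simp only: x1 power_one)
  hence "q + \<theta>\<^sup>2 = (\<Sum>j\<in>{1..q}. (F0.x 1 j)\<^sup>2) + (F0.x 1 (Suc q))\<^sup>2"
    by (simp only: x2) simp
  also have "\<dots> = (\<Sum>j\<in>{1..Suc q}. (F0.x 1 j)\<^sup>2)" by simp
  also have "\<dots> \<le> (\<Sum>j\<in>V. (F0.x 1 j)\<^sup>2)"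
    using F0(5) by (intro sum_mono2) (auto simp: V_def)
  finally have "q + \<theta>\<^sup>2 - \<alpha> * \<kappa> \<le> t * F0.S"
    using F0.t_S_ge[OF one] by (simp add: same)
  moreover have "real (total_intersection n (extremal_family n ?s)) \<ge> M\<^sup>2 * (F0.S + \<kappa>\<^sup>2)"
    using extremal_family_ge[OF pos F0(1)] F0.total_intersection_eq by (simp add: same)
  ultimately show "\<exists>S'. real (total_intersection n (extremal_family n (card F))) \<ge> M\<^sup>2 * (S' + \<kappa>\<^sup>2) \<and>
       q + \<theta>\<^sup>2 - \<alpha> * \<kappa> \<le> t * S'" by blast
qed

text \<open>Comparison with the competitor gives
  \<open>\<rho> \<le> \<theta> * (1 - \<theta>) + \<delta>\<close>, where \<theta> is the fractional
  part of \<kappa>.\<close>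

lemma \<rho>_le:
  fixes k :: nat and \<epsilon> \<delta> :: real
  assumes pos: "card F > 0" and lt: "card F < fact n"
    and \<kappa>: "\<kappa> = k + \<epsilon>" "-1/2 < \<epsilon>" "\<epsilon> \<le> 1/2" and "\<delta> \<ge> 0"
    and I: "real (total_intersection n F) \<ge> real (total_intersection n (extremal_family n (card F))) - \<delta> * M\<^sup>2"
  shows "\<rho> \<le> \<bar>\<epsilon>\<bar> + \<delta>"
proof -
  define q where "q = card F div fact (n - 1)"
  define \<theta> where "\<theta> = \<kappa> - q"
  note ext = total_intersection_extremal_ge[OF pos lt, folded q_def \<theta>_def]
  obtain S' where S': "real (total_intersection n (extremal_family n (card F))) \<ge> M\<^sup>2 * (S' + \<kappa>\<^sup>2)"
     "q + \<theta>\<^sup>2 - \<alpha> * \<kappa> \<le> t * S'"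
    using ext(3) by blast
  have "M\<^sup>2 * (S' + \<kappa>\<^sup>2) - \<delta> * M\<^sup>2 \<le> M\<^sup>2 * (S + \<kappa>\<^sup>2)"
    using I S'(1) unfolding total_intersection_eq by linarith
  hence "M\<^sup>2 * (S' + \<kappa>\<^sup>2 - \<delta>) \<le> M\<^sup>2 * (S + \<kappa>\<^sup>2)" by (simp add: algebra_simps)
  hence "S' - \<delta> \<le> S" using M_pos by simp
  hence "t * S' - t * \<delta> \<le> t * S" using t_bounds by (simp flip: right_diff_distrib)
  moreover have "t * \<delta> \<le> \<delta>" using t_bounds \<open>\<delta> \<ge> 0\<close> by (simp add: mult_left_le_one_le)
  ultimately have "\<rho> \<le> \<kappa> - q - \<theta>\<^sup>2 + \<delta>" using S'(2) unfolding \<rho>_def by linarith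
  also have "\<kappa> - q - \<theta>\<^sup>2 = \<theta> * (1 - \<theta>)" by (simp add: \<theta>_def algebra_simps power2_eq_square)
  also have "\<dots> \<le> \<bar>\<epsilon>\<bar>"
  proof -
    \<comment> \<open>Either \<open>k = q\<close> and \<open>\<epsilon> = \<theta>\<close>, or
      \<open>k = Suc q\<close> and \<open>\<epsilon> = \<theta> - 1\<close>.\<close>
    have "real_of_int (int k - int q) = \<theta> - \<epsilon>" using \<kappa> by (simp add: \<theta>_def)
    hence "real_of_int (int k - int q) < 2" "real_of_int (int k - int q) > -1" using \<kappa> ext by linarith+
    hence "int k - int q < 2" "int k - int q > -1" by linarith+
    hence "k = q \<or> k = Suc q" by linarith
    moreover have "\<theta> * (1 - \<theta>) \<le> \<theta> * 1" "\<theta> * (1 - \<theta>) \<le> 1 * (1 - \<theta>)"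
      using ext(1,2) by (intro mult_left_mono mult_right_mono; simp)+
    ultimately show ?thesis using \<kappa>(1) by (auto simp: \<theta>_def)
  qed
  finally show ?thesis by simp
qed

section \<open>Families at distance zero\<close>

lemma f_degree_one:
  assumes "\<rho> = 0" "\<sigma> \<in> Sym n"
  shows "f \<sigma> = (\<Sum>i\<in>{1..n}. \<alpha> / n + t * y i (\<sigma> i))"
proof -
  have "(\<Sum>\<sigma>\<in>Sym n. (e \<sigma>)\<^sup>2) = 0" using sum_e_square assms(1) by simp
  hence "e \<sigma> = 0" using assms(2) by (subst (asm) sum_nonneg_eq_0_iff) auto
  hence "f \<sigma> = h \<sigma>" by (simp add: e_def)
  \<comment> \<open>The constant \<alpha> is shared equally among the \<open>n\<close> rows.\<close>
  thus ?thesis using n by (simp add: h_def g_def V_def sum.distrib sum_distrib_left)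
qed

text \<open>By \<open>Boolean_degree_one\<close>, membership in \<open>F\<close> is decided by the
  value at one point or by the preimage of one value. Cosets with a common argument, or with a
  common value, are pairwise disjoint.\<close>

lemma union_of_disjoint_cosets:
  assumes "\<rho> = 0"
  obtains P where "P \<subseteq> one_cosets n" "pairwise disjnt P" "F = \<Union>P"
proof -
  let ?a = "\<lambda>i j. \<alpha> / n + t * y i j"
  have Feq: "{\<sigma>\<in>Sym n. (\<Sum>i\<in>{1..n}. ?a i (\<sigma> i)) = 1} = F"
  proof -
    have "{\<sigma>\<in>Sym n. (\<Sum>i\<in>{1..n}. ?a i (\<sigma> i)) = 1} = {\<sigma>\<in>Sym n. f \<sigma> = 1}"
      by (intro Collect_cong conj_cong refl) (simp only: f_degree_one[OF assms])
    also have "\<dots> = F" using F by (auto simp: f_def)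
    finally show ?thesis .
  qed
  have "(\<Sum>i\<in>{1..n}. ?a i (\<sigma> i)) \<in> {0,1}" if "\<sigma> \<in> Sym n" for \<sigma>
    unfolding f_degree_one[OF assms that, symmetric] by (simp add: f_def)
  from n this show thesis
  proof (rule Boolean_degree_one)
    fix u J assume u: "u \<in> {1..n}" "J \<subseteq> {1..n}"
      "{\<sigma>\<in>Sym n. (\<Sum>i\<in>{1..n}. ?a i (\<sigma> i)) = 1} = {\<sigma>\<in>Sym n. \<sigma> u \<in> J}"
    show thesis
    proof (rule that[of "one_coset n u ` J"])
      show "one_coset n u ` J \<subseteq> one_cosets n" using u unfolding one_cosets_def by blast
      show "pairwise disjnt (one_coset n u ` J)" by (auto simp: pairwise_def disjnt_def one_coset_alt)
      show "F = \<Union>(one_coset n u ` J)" using Feq u(3) by (auto simp: one_coset_alt)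
    qed
  next
    fix u J assume u: "u \<in> {1..n}" "J \<subseteq> {1..n}"
      "{\<sigma>\<in>Sym n. (\<Sum>i\<in>{1..n}. ?a i (\<sigma> i)) = 1} = {\<sigma>\<in>Sym n. inv \<sigma> u \<in> J}"
    have inv: "inv \<sigma> u = i \<longleftrightarrow> \<sigma> i = u" if "\<sigma> \<in> Sym n" for \<sigma> i
      using that by (auto simp: Sym_def permutes_inv_eq)
    show thesis
    proof (rule that[of "(\<lambda>i. one_coset n i u) ` J"])
      show "(\<lambda>i. one_coset n i u) ` J \<subseteq> one_cosets n" using u unfolding one_cosets_def by blast
      show "pairwise disjnt ((\<lambda>i. one_coset n i u) ` J)"
      proof -
        have "i = i'" if "\<sigma> \<in> Sym n" "\<sigma> i = u" "\<sigma> i' = u" for \<sigma> i i'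
          using that(2,3) Sym_inj[OF that(1), of i i'] by simp
        hence "disjnt (one_coset n i u) (one_coset n i' u)" if "i \<noteq> i'" for i i'
          using that unfolding disjnt_def one_coset_alt by blast
        thus ?thesis unfolding pairwise_def by (metis imageE)
      qed
      have "F = {\<sigma>\<in>Sym n. inv \<sigma> u \<in> J}" using Feq u(3) by simp
      also have "\<dots> = {\<sigma>\<in>Sym n. \<exists>i\<in>J. \<sigma> i = u}"
        using inv by (intro Collect_cong conj_cong refl) metis
      finally show "F = \<Union>((\<lambda>i. one_coset n i u) ` J)" by (auto simp: one_coset_alt)
    qed
  qed
qed

end

lemma card_Union_disjoint_cosets:
  assumes "P \<subseteq> one_cosets n" "pairwise disjnt P"
  shows "card (\<Union>P) = card P * fact (n - 1)"
proof -
  have "card (\<Union>P) = (\<Sum>C\<in>P. card C)"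
    using assms by (intro card_Union_disjoint) (auto simp: one_cosets_def)
  also have "\<dots> = (\<Sum>C\<in>P. fact (n - 1))"
    using assms(1) card_one_coset' by (intro sum.cong refl) (auto simp: one_cosets_def simp del: atLeastAtMost_iff One_nat_def)
  finally show ?thesis by simp
qed

subsection \<open>Stability\<close>

text \<open>A Bonferroni inequality, by induction on \<open>L\<close>; the number of pairs is
  bounded crudely by \<open>(card L)\<^sup>2\<close>.\<close>

lemma sum_card_Int_le_card_Int_UN:
  assumes "finite L" "finite A" "\<And>p. p \<in> L \<Longrightarrow> finite (B p)"
    and "\<And>p q. p \<in> L \<Longrightarrow> q \<in> L \<Longrightarrow> p \<noteq> q \<Longrightarrow> card (B p \<inter> B q) \<le> c"
  shows "(\<Sum>p\<in>L. card (A \<inter> B p)) \<le> card (A \<inter> (\<Union>p\<in>L. B p)) + c * (card L)\<^sup>2"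
  using assms(1,3,4)
proof (induction L)
  case empty
  thus ?case by simp
next
  case (insert p L)
  let ?U = "\<Union>q\<in>L. B q"
  have IH: "(\<Sum>q\<in>L. card (A \<inter> B q)) \<le> card (A \<inter> ?U) + c * (card L)\<^sup>2"
    using insert.prems by (intro insert.IH) auto
  have "card (A \<inter> B p) + card (A \<inter> ?U) = card (A \<inter> B p \<union> A \<inter> ?U) + card (A \<inter> B p \<inter> (A \<inter> ?U))"
    using assms(2) by (intro card_Un_Int) auto
  also have "A \<inter> B p \<union> A \<inter> ?U = A \<inter> (\<Union>q\<in>insert p L. B q)" by auto
  finally have split: "card (A \<inter> B p) + card (A \<inter> ?U) =
    card (A \<inter> (\<Union>q\<in>insert p L. B q)) + card (A \<inter> B p \<inter> (A \<inter> ?U))" .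
  have "card (A \<inter> B p \<inter> (A \<inter> ?U)) \<le> card (\<Union>q\<in>L. B p \<inter> B q)"
    using insert by (intro card_mono) auto
  also have "\<dots> \<le> (\<Sum>q\<in>L. card (B p \<inter> B q))"
    by (rule card_UN_le[OF insert.hyps(1)])
  also have "\<dots> \<le> (\<Sum>q\<in>L. c)"
    using insert by (intro sum_mono) auto
  finally have "card (A \<inter> B p \<inter> (A \<inter> ?U)) \<le> c * card L" by (simp add: mult.commute)
  moreover have "c * (card L)\<^sup>2 + c * card L \<le> c * (card (insert p L))\<^sup>2"
    using insert.hyps by (simp add: power2_eq_square algebra_simps)
  moreover have "(\<Sum>q\<in>insert p L. card (A \<inter> B q)) = card (A \<inter> B p) + (\<Sum>q\<in>L. card (A \<inter> B q))"
    using insert.hyps by simp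
  ultimately show ?case using IH split by linarith
qed

text \<open>Trimming the excess or filling the deficit of \<open>L\<close> reaches the exact size
  \<open>k\<close>.\<close>

lemma ex_subset_or_superset_with_card:
  assumes "finite X" "L \<subseteq> X" "k \<le> card X"
  obtains L' where "L' \<subseteq> X" "card L' = k" "card (sym_diff L L') \<le> nat \<bar>int (card L) - int k\<bar>"
proof (cases "k \<le> card L")
  case True
  then obtain L' where L': "L' \<subseteq> L" "card L' = k" by (meson obtain_subset_with_card_n)
  have "sym_diff L L' = L - L'" using L' by auto
  moreover have "card (L - L') = card L - k"
    using L' assms finite_subset by (metis card_Diff_subset)
  ultimately show ?thesis using that[of L'] L' assms True by auto
next
  case False
  have fin: "finite L" using assms finite_subset by blast
  have "k - card L \<le> card (X - L)"
    using assms fin by (simp add: card_Diff_subset)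
  then obtain E where E: "E \<subseteq> X - L" "card E = k - card L" by (meson obtain_subset_with_card_n)
  have finE: "finite E" using E assms finite_subset by (metis finite_Diff)
  have "sym_diff L (L \<union> E) = E" using E by auto
  moreover have "card (L \<union> E) = k"
    using E fin finE False by (subst card_Un_disjoint) auto
  moreover have "L \<union> E \<subseteq> X" using E assms by blast
  ultimately show ?thesis using E False by (intro that[of "L \<union> E"]) simp_all
qed

context permutation_family begin

section \<open>Intersections of cosets and nearly full cosets\<close>

lemma card_coset_Int_coset:
  assumes "(i,j) \<in> V \<times> V" "(i',j') \<in> V \<times> V" "(i,j) \<noteq> (i',j')"
  shows "card (coset i j \<inter> coset i' j') \<le> fact (n - 2)"
proof (cases "i \<noteq> i' \<and> j \<noteq> j'")
  case True
  have "coset i j \<inter> coset i' j' = {\<sigma>\<in>Sym n. \<sigma> i = j \<and> \<sigma> i' = j'}" by auto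
  thus ?thesis using card_two_cosets[of i n j i' j'] True assms by (simp add: V_def)
next
  case False
  hence empty: "coset i j \<inter> coset i' j' = {}" using assms(3) Sym_inj by fastforce
  show ?thesis by (subst empty) simp
qed

text \<open>Cosets of different cells share at most \<open>fact (n - 2)\<close> elements, fewer than
  a coset has. Hence counting cells is counting cosets.\<close>

lemma inj_on_coset: "inj_on (\<lambda>(i,j). coset i j) (V \<times> V)"
proof (rule inj_onI, clarify)
  fix i j i' j' assume V: "i \<in> V" "j \<in> V" "i' \<in> V" "j' \<in> V" and eq: "coset i j = coset i' j'"
  have "fact (n - 2) < (fact (n - 1) :: nat)" using n by (intro fact_less_mono) auto
  moreover have "fact (n - 1) \<le> (fact (n - 2) :: nat)" if "(i,j) \<noteq> (i',j')"
    using card_coset_Int_coset[of i j i' j'] that V eq card_coset[of i j] by simp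
  ultimately show "i = i' \<and> j = j'" by force
qed

text \<open>Cells in \<open>L\<close> have \<open>y \<ge> 1/4\<close> because
  \<open>\<alpha> \<le> 1/2\<close>, and the others have \<open>1 - x > 1/4\<close>. So the
  deviation controls both the parts of the cosets in \<open>L\<close> missing from \<open>F\<close>
  and the share of \<open>S\<close> outside \<open>L\<close>; comparing \<open>S\<close> with
  \<kappa> then estimates \<open>card L\<close>.\<close>

lemma coset_approximation:
  fixes L :: "(nat \<times> nat) set"
  assumes "\<kappa> \<ge> 1/2"
  defines "L \<equiv> {p\<in>V \<times> V. x (fst p) (snd p) \<ge> 3/4}"
  assumes \<alpha>: "\<alpha> \<le> 1/2"
  shows "(\<Sum>p\<in>L. 1 - x (fst p) (snd p)) \<le> 16 * deviation"
    and "real (card L) \<le> 32 * \<kappa>"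
    and "\<kappa> - \<alpha> * \<kappa> - \<rho> - 4 * deviation \<le> card L"
    and "card L \<le> \<kappa> + 2 * \<kappa> / n + 64 * (\<alpha> * \<kappa>) + 32 * deviation"
proof -
  let ?x = "\<lambda>p. x (fst p) (snd p)" and ?y = "\<lambda>p. y (fst p) (snd p)"
  have L: "L \<subseteq> V \<times> V" "finite L" by (auto simp: L_def)
  have x1: "?x p \<le> 1" if "p \<in> V \<times> V" for p using that by (auto intro: x_le_1)
  have S: "S = (\<Sum>p\<in>V \<times> V. (?y p)\<^sup>2)"
    by (simp add: S_def sum.cartesian_product case_prod_beta)
  have dev: "deviation = (\<Sum>p\<in>V \<times> V. (?y p)\<^sup>2 * (1 - ?x p))"
    by (simp add: deviation_def sum.cartesian_product case_prod_beta)
  have dev_ge: "(\<Sum>p\<in>X. (?y p)\<^sup>2 * (1 - ?x p)) \<le> deviation" if "X \<subseteq> V \<times> V" for X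
    unfolding dev using that x1 by (intro sum_mono2) auto
  have S_ge: "(\<Sum>p\<in>X. (?y p)\<^sup>2) \<le> S" if "X \<subseteq> V \<times> V" for X
    unfolding S using that by (intro sum_mono2) auto
  have y4: "1/4 \<le> ?y p" if "p \<in> L" for p using that \<alpha> by (auto simp: L_def y_def)
  have y16: "1/16 \<le> (?y p)\<^sup>2" if "p \<in> L" for p
    using power_mono[OF y4[OF that], of 2] by (simp add: power2_eq_square)
  show 1: "(\<Sum>p\<in>L. 1 - ?x p) \<le> 16 * deviation"
  proof -
    have "1 - ?x p \<le> 16 * ((?y p)\<^sup>2 * (1 - ?x p))" if "p \<in> L" for p
      using mult_right_mono[OF y16[OF that], of "1 - ?x p"] x1[of p] L that by auto
    hence "(\<Sum>p\<in>L. 1 - ?x p) \<le> (\<Sum>p\<in>L. 16 * ((?y p)\<^sup>2 * (1 - ?x p)))" by (intro sum_mono)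
    thus ?thesis using dev_ge[OF L(1)] by (simp flip: sum_distrib_left)
  qed
  have S2: "S \<le> 2 * \<kappa>"
  proof -
    have "\<kappa> * (2 / n) \<le> \<kappa> * 1" using n assms(1) by (intro mult_left_mono) auto
    hence "2 * \<kappa> / n \<le> \<kappa>" by (simp add: mult.commute)
    thus ?thesis using S_le by linarith
  qed
  show 2: "real (card L) \<le> 32 * \<kappa>"
  proof -
    have "(\<Sum>p\<in>L. 1/16) \<le> (\<Sum>p\<in>L. (?y p)\<^sup>2)" using y16 by (intro sum_mono)
    hence "real (card L) \<le> 16 * S" using S_ge[OF L(1)] by simp
    thus ?thesis using S2 by linarith
  qed
  show "\<kappa> - \<alpha> * \<kappa> - \<rho> - 4 * deviation \<le> card L"
  proof -
    have "\<kappa> - \<alpha> * \<kappa> - \<rho> = t * S" by (simp add: \<rho>_def)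
    also have "\<dots> \<le> S" using t_bounds S_nonneg by (simp add: mult_left_le_one_le)
    also have "S = (\<Sum>p\<in>L. (?y p)\<^sup>2) + (\<Sum>p\<in>V \<times> V - L. (?y p)\<^sup>2)"
      unfolding S using L sum.subset_diff[of L "V \<times> V" "\<lambda>p. (?y p)\<^sup>2"] by simp
    also have "(\<Sum>p\<in>L. (?y p)\<^sup>2) \<le> (\<Sum>p\<in>L. 1)"
    proof (rule sum_mono)
      fix p assume "p \<in> L"
      hence "\<bar>?y p\<bar> \<le> 1" using L by (intro abs_y_le_1) auto
      thus "(?y p)\<^sup>2 \<le> 1" by (simp add: abs_square_le_1)
    qed
    also have "(\<Sum>p\<in>V \<times> V - L. (?y p)\<^sup>2) \<le> (\<Sum>p\<in>V \<times> V - L. 4 * ((?y p)\<^sup>2 * (1 - ?x p)))"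
    proof (rule sum_mono)
      fix p assume "p \<in> V \<times> V - L"
      hence "1/4 \<le> 1 - ?x p" by (auto simp: L_def)
      from mult_left_mono[OF this, of "(?y p)\<^sup>2"] show "(?y p)\<^sup>2 \<le> 4 * ((?y p)\<^sup>2 * (1 - ?x p))" by simp
    qed
    also have "\<dots> \<le> 4 * deviation" using dev_ge[of "V \<times> V - L"] by (simp flip: sum_distrib_left)
    finally show ?thesis by simp
  qed
  show "card L \<le> \<kappa> + 2 * \<kappa> / n + 64 * (\<alpha> * \<kappa>) + 32 * deviation"
  proof -
    \<comment> \<open>This is \<open>2 * y - 1 \<le> y\<^sup>2\<close> with
      \<open>y = x - \<alpha>\<close>.\<close>
    have "1 - 2 * (1 - ?x p) - 2 * \<alpha> \<le> (?y p)\<^sup>2" for p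
      using zero_le_power2[of "?y p - 1"] by (simp add: y_def power2_eq_square algebra_simps)
    hence "(\<Sum>p\<in>L. 1 - 2 * (1 - ?x p) - 2 * \<alpha>) \<le> (\<Sum>p\<in>L. (?y p)\<^sup>2)" by (intro sum_mono)
    also have "\<dots> \<le> S" by (rule S_ge[OF L(1)])
    finally have "(\<Sum>p\<in>L. 1 - 2 * (1 - ?x p) - 2 * \<alpha>) \<le> S" .
    hence "card L - 2 * (\<Sum>p\<in>L. 1 - ?x p) - 2 * \<alpha> * card L \<le> S"
      by (simp only: sum_subtractf sum_distrib_left[symmetric]) (simp add: algebra_simps)
    moreover have "\<alpha> * card L \<le> \<alpha> * (32 * \<kappa>)" using 2 \<alpha>_bounds by (intro mult_left_mono)
    ultimately show ?thesis using 1 S_le by linarith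
  qed
qed

text \<open>The symmetric difference is covered by the two differences between \<open>F\<close> and
  the union over \<open>L\<close>, and the cosets indexed by \<open>sym_diff L L'\<close>, each of
  size \<open>M\<close>. The part of \<open>F\<close> outside the union is estimated by the
  Bonferroni inequality, which produces the term with \<open>(card L)\<^sup>2\<close>.\<close>

lemma card_sym_diff_cosets:
  fixes L :: "(nat \<times> nat) set"
  assumes L: "L \<subseteq> V \<times> V" and L': "L' \<subseteq> V \<times> V"
  shows "real (card (sym_diff F (\<Union>(i,j)\<in>L'. coset i j))) \<le>
    M * (\<kappa> - card L + 2 * (\<Sum>p\<in>L. 1 - x (fst p) (snd p)) + (card L)\<^sup>2 / (real n - 1) + card (sym_diff L L'))"
proof -
  let ?x = "\<lambda>p. x (fst p) (snd p)"
  define C where "C p = coset (fst p) (snd p)" for p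
  define U where "U L = (\<Union>p\<in>L. C p)" for L
  have fin: "finite (C p)" for p by (simp add: C_def)
  have finL: "finite L" "finite L'" using L L' finite_subset finite_V by blast+
  have cardC: "real (card (C p)) = M" if "p \<in> V \<times> V" for p
    using that card_coset[of "fst p" "snd p"] by (auto simp: C_def M_def)
  have cardF: "real (card (F \<inter> C p)) = M * ?x p" for p
  proof -
    have "F \<inter> C p = {\<sigma>\<in>F. \<sigma> (fst p) = snd p}" using F by (auto simp: C_def)
    thus ?thesis using M_pos by (simp add: x_def)
  qed
  have "card (U L - F) \<le> (\<Sum>p\<in>L. card (C p - F))"
  proof -
    have "U L - F = (\<Union>p\<in>L. C p - F)" by (auto simp: U_def)
    thus ?thesis using card_UN_le[OF finL(1), of "\<lambda>p. C p - F"] by simp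
  qed
  hence "real (card (U L - F)) \<le> (\<Sum>p\<in>L. real (card (C p - F)))"
    by (simp flip: of_nat_sum)
  also have "\<dots> = (\<Sum>p\<in>L. M * (1 - ?x p))"
  proof (rule sum.cong[OF refl])
    fix p assume "p \<in> L"
    have "real (card (C p)) = real (card (C p - F)) + real (card (F \<inter> C p))"
      using card_Diff_subset_Int[of "C p" F] card_mono[of "C p" "C p \<inter> F"] fin
      by (simp add: Int_commute of_nat_diff)
    thus "real (card (C p - F)) = M * (1 - ?x p)"
      using cardC[of p] cardF[of p] \<open>p \<in> L\<close> L by (auto simp: algebra_simps)
  qed
  finally have UF: "real (card (U L - F)) \<le> M * (\<Sum>p\<in>L. 1 - ?x p)"
    by (simp add: sum_distrib_left)
  have "(\<Sum>p\<in>L. card (F \<inter> C p)) \<le> card (F \<inter> U L) + fact (n - 2) * (card L)\<^sup>2"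
    unfolding U_def
  proof (rule sum_card_Int_le_card_Int_UN[OF finL(1) finite_F fin])
    fix p q assume "p \<in> L" "q \<in> L" "p \<noteq> q"
    thus "card (C p \<inter> C q) \<le> fact (n - 2)"
      using card_coset_Int_coset[of "fst p" "snd p" "fst q" "snd q"] L by (auto simp: C_def)
  qed
  hence "real (\<Sum>p\<in>L. card (F \<inter> C p)) \<le> real (card (F \<inter> U L) + fact (n - 2) * (card L)\<^sup>2)"
    by (simp only: of_nat_le_iff)
  hence "(\<Sum>p\<in>L. M * ?x p) \<le> real (card (F \<inter> U L)) + M / (real n - 1) * (card L)\<^sup>2"
    by (simp only: of_nat_add of_nat_mult of_nat_sum cardF fact_n2 of_nat_power)
  moreover have "(\<Sum>p\<in>L. M * ?x p) = M * card L - M * (\<Sum>p\<in>L. 1 - ?x p)"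
    by (simp add: sum_subtractf algebra_simps sum_distrib_left)
  moreover have "real (card (F - U L)) = M * \<kappa> - real (card (F \<inter> U L))"
    using card_Diff_subset_Int[of F "U L"] card_mono[of F "F \<inter> U L"] M_pos
    by (simp add: of_nat_diff \<kappa>_def)
  ultimately have FU: "real (card (F - U L)) \<le>
      M * \<kappa> - M * card L + M * (\<Sum>p\<in>L. 1 - ?x p) + M / (real n - 1) * (card L)\<^sup>2"
    by linarith
  have sub: "sym_diff F (U L') \<subseteq> (F - U L) \<union> (U L - F) \<union> U (sym_diff L L')"
    by (auto simp: U_def)
  have "card (sym_diff F (U L')) \<le> card ((F - U L) \<union> (U L - F) \<union> U (sym_diff L L'))"
    using fin finL by (intro card_mono sub) (auto simp: U_def)
  also have "\<dots> \<le> card (F - U L) + card (U L - F) + card (U (sym_diff L L'))"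
    by (meson card_Un_le add_right_mono order.trans)
  also have "card (U (sym_diff L L')) \<le> (\<Sum>p\<in>sym_diff L L'. card (C p))"
    unfolding U_def using finL by (intro card_UN_le) auto
  finally have "real (card (sym_diff F (U L'))) \<le> real (card (F - U L)) + real (card (U L - F))
      + (\<Sum>p\<in>sym_diff L L'. real (card (C p)))"
    by (simp flip: of_nat_sum of_nat_add)
  also have "(\<Sum>p\<in>sym_diff L L'. real (card (C p))) = (\<Sum>p\<in>sym_diff L L'. M)"
    using L L' cardC by (intro sum.cong refl) blast
  also have "\<dots> = M * card (sym_diff L L')" by simp
  finally have "real (card (sym_diff F (U L'))) \<le> real (card (F - U L)) + real (card (U L - F))
      + M * card (sym_diff L L')" .
  also have "\<dots> \<le> M * \<kappa> - M * card L + M * (\<Sum>p\<in>L. 1 - ?x p) + M / (real n - 1) * (card L)\<^sup>2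
      + M * (\<Sum>p\<in>L. 1 - ?x p) + M * card (sym_diff L L')"
    using FU UF by linarith
  also have "\<dots> = M * (\<kappa> - card L + 2 * (\<Sum>p\<in>L. 1 - ?x p) + (card L)\<^sup>2 / (real n - 1) + card (sym_diff L L'))"
    by (simp add: algebra_simps)
  finally show ?thesis by (simp add: U_def C_def case_prod_beta)
qed

text \<open>Every error term is compared with one quantity \<open>W\<close>, the asserted bound
  without its constant and in units of \<open>M\<close>.\<close>

lemma stability:
  fixes k :: nat and \<epsilon> \<tau> :: real
  assumes \<kappa>: "\<kappa> = k + \<epsilon>" "k \<ge> 1" "\<bar>\<epsilon>\<bar> \<le> 1/2" and k: "real k \<le> (real n - 1) / 2"
    and \<tau>: "\<rho> \<le> \<tau>" "\<bar>\<epsilon>\<bar> \<le> \<tau>" "\<tau> \<le> 2 * real k"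
  obtains P where "P \<subseteq> one_cosets n" "card P = k"
    "real (card (sym_diff F (\<Union>P))) \<le> 11000 * (sqrt (2 * real k * \<tau>) + k / n) * card F"
proof -
  define W where "W = (sqrt (2 * real k * \<tau>) + k / n) * \<kappa>"
  have \<tau>0: "0 \<le> \<tau>" using \<tau>(2) by linarith
  have k1: "1 \<le> real k" using \<kappa>(2) by simp
  have \<kappa>h: "\<kappa> \<ge> 1/2" "\<kappa> \<le> 2 * real k" using \<kappa>(1,3) k1 by linarith+
  have W1: "sqrt (2 * real k * \<tau>) * \<kappa> \<le> W" and W2: "k / n * \<kappa> \<le> W"
    using \<kappa>h \<tau>0 by (auto simp: W_def algebra_simps)
  have W0: "0 \<le> W" using \<kappa>h \<tau>0 by (auto simp: W_def)
  have "\<rho> \<le> 1 * \<tau>" using \<tau>(1) by simp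
  also have "\<dots> \<le> 2 * real k * \<tau>" using k1 \<tau>0 by (intro mult_right_mono) auto
  finally have "sqrt \<rho> \<le> sqrt (2 * real k * \<tau>)" by simp
  hence "\<kappa> * sqrt \<rho> \<le> \<kappa> * sqrt (2 * real k * \<tau>)" using \<kappa>h by (intro mult_left_mono) auto
  hence b1: "\<kappa> * sqrt \<rho> \<le> W" using W1 by (simp add: mult.commute)
  \<comment> \<open>The bound \<open>\<tau> \<le> 2 * real k\<close> lets a linear \<tau> be
    absorbed by the square root.\<close>
  have "\<tau> * \<tau> \<le> 2 * real k * \<tau>" using \<tau>(3) \<tau>0 by (intro mult_right_mono)
  hence "\<tau> \<le> sqrt (2 * real k * \<tau>)" by (intro real_le_rsqrt) (simp add: power2_eq_square)
  also have "\<dots> \<le> 2 * \<kappa> * sqrt (2 * real k * \<tau>)"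
    using mult_right_mono[of 1 "2 * \<kappa>" "sqrt (2 * real k * \<tau>)"] \<kappa>h \<tau>0 by simp
  finally have b2: "\<tau> \<le> 2 * W" using W1 by (simp add: mult.commute)
  have "\<alpha> * \<kappa> \<le> 2 * real k / n * \<kappa>"
    unfolding \<alpha>_def using \<kappa>h by (intro mult_right_mono divide_right_mono) auto
  hence b3: "\<alpha> * \<kappa> \<le> 2 * W" using W2 by simp
  have "1 / n * \<kappa> \<le> k / n * \<kappa>"
    using k1 \<kappa>h by (intro mult_right_mono divide_right_mono) auto
  hence b4: "\<kappa> / n \<le> W" using W2 by simp
  have \<alpha>h: "\<alpha> \<le> 1/2"
  proof -
    have "\<epsilon> \<le> 1/2" using \<kappa>(3) by linarith
    hence "\<kappa> \<le> (real n - 1) / 2 + 1/2" using \<kappa>(1) k by linarith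
    hence "\<kappa> \<le> n / 2" by (simp add: field_simps)
    thus ?thesis using n by (simp add: \<alpha>_def field_simps)
  qed
  \<comment> \<open>90 = 4 + 4 + 82, from \<open>2 * \<rho>\<close>,
    \<open>4 * \<kappa> * sqrt \<rho>\<close> and \<open>41 * (\<alpha> * \<kappa>)\<close>.\<close>
  have dev: "deviation \<le> 90 * W"
    using deviation_le[OF \<kappa>h(1)] b1 b2 b3 \<tau>(1) by linarith
  define L where "L = {p\<in>V \<times> V. x (fst p) (snd p) \<ge> 3/4}"
  have L: "L \<subseteq> V \<times> V" by (auto simp: L_def)
  note approx = coset_approximation[OF \<kappa>h(1) \<alpha>h, folded L_def]
  \<comment> \<open>364 = 2 + 2 + 360 here, and 3010 = 2 + 128 + 2880 in
    \<open>upper\<close>.\<close>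
  have lower: "\<kappa> - card L \<le> 364 * W"
    using approx(3) b2 b3 \<tau>(1) dev by linarith
  have upper: "card L - \<kappa> \<le> 3010 * W"
    using approx(4) b3 b4 dev by linarith
  have sq: "(card L)\<^sup>2 / (real n - 1) \<le> 4096 * W"
  proof -
    have "(real (card L))\<^sup>2 \<le> (32 * \<kappa>)\<^sup>2" using approx(2) by (intro power_mono) auto
    hence "(real (card L))\<^sup>2 / (real n - 1) \<le> (32 * \<kappa>)\<^sup>2 / (real n - 1)"
      using n by (intro divide_right_mono) auto
    also have "\<dots> \<le> (32 * \<kappa>)\<^sup>2 * (2 / n)"
    proof -
      have "1 / (real n - 1) \<le> 2 / n" using n by (simp add: field_simps)
      from mult_left_mono[OF this, of "(32 * \<kappa>)\<^sup>2"] show ?thesis by simp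
    qed
    also have "\<dots> = 2048 * (\<alpha> * \<kappa>)" by (simp add: \<alpha>_def power2_eq_square)
    finally show ?thesis using b3 by simp
  qed
  have fin: "finite (V \<times> V)" by simp
  have "k \<le> card (V \<times> V)"
  proof -
    have "real k \<le> real n" using k by (simp add: field_simps)
    hence "k \<le> n" by simp
    also have "n \<le> n * n" by simp
    finally show ?thesis by (simp add: card_cartesian_product)
  qed
  from ex_subset_or_superset_with_card[OF fin L this]
  obtain L' where L': "L' \<subseteq> V \<times> V" "card L' = k" "card (sym_diff L L') \<le> nat \<bar>int (card L) - int k\<bar>" .
  have "real (card (sym_diff L L')) \<le> \<bar>real (card L) - real k\<bar>"
    using L'(3) by linarith
  \<comment> \<open>Passing from \<kappa> to \<open>k\<close> adds
    \<open>\<bar>\<epsilon>\<bar> \<le> \<tau> \<le> 2 * W\<close>.\<close>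
  also have "\<dots> \<le> 3012 * W" using lower upper \<kappa>(1) \<tau>(2) b2 W0 by linarith
  finally have diff: "real (card (sym_diff L L')) \<le> 3012 * W" .
  define P where "P = (\<lambda>(i,j). coset i j) ` L'"
  show thesis
  proof (rule that[of P])
    show "P \<subseteq> one_cosets n"
    proof
      fix C assume "C \<in> P"
      then obtain i j where "(i,j) \<in> L'" and C: "C = coset i j" by (auto simp: P_def)
      hence "i \<in> {1..n}" "j \<in> {1..n}" using L'(1) unfolding V_def by blast+
      thus "C \<in> one_cosets n" unfolding one_cosets_def one_coset_def C by blast
    qed
    show "card P = k"
      unfolding P_def using L'(2) inj_on_subset[OF inj_on_coset L'(1)] by (simp add: card_image)
    have "real (card (sym_diff F (\<Union>P))) \<le> M * (\<kappa> - card L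
        + 2 * (\<Sum>p\<in>L. 1 - x (fst p) (snd p)) + (card L)\<^sup>2 / (real n - 1) + card (sym_diff L L'))"
      unfolding P_def by (rule card_sym_diff_cosets[OF L L'(1)])
    \<comment> \<open>364 + 2880 + 4096 + 3012 = 10352, rounded up.\<close>
    also have "\<dots> \<le> M * (11000 * W)"
      using lower approx(1) dev sq diff W0 M_pos by (intro mult_left_mono) linarith+
    also have "\<dots> = 11000 * (sqrt (2 * real k * \<tau>) + k / n) * card F"
      using M_pos by (simp add: W_def \<kappa>_def)
    finally show "real (card (sym_diff F (\<Union>P))) \<le> 11000 * (sqrt (2 * real k * \<tau>) + k / n) * card F" .
  qed
qed

end

theorem theorem1p6:
  "\<exists>C\<^sub>0 c :: real. C\<^sub>0 > 0 \<and> c > 0 \<and>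
     (\<exists>N :: nat. \<forall>n \<ge> N. \<forall>(k :: nat) (\<epsilon> :: real) (\<delta> :: real) (F :: (nat \<Rightarrow> nat) set).
        real k \<le> (real n - 1) / 2 \<longrightarrow>
        \<epsilon> \<in> {-1/2 <.. 1/2} \<longrightarrow> \<delta> \<ge> 0 \<longrightarrow> max \<bar>\<epsilon>\<bar> \<delta> \<le> c * real k \<longrightarrow>
        F \<subseteq> Sym n \<longrightarrow> real (card F) = (real k + \<epsilon>) * fact (n - 1) \<longrightarrow>
        real (total_intersection n F)
          \<ge> real (total_intersection n (extremal_family n (card F))) - \<delta> * (fact (n - 1))\<^sup>2 \<longrightarrow>
        (\<exists>P \<subseteq> one_cosets n. card P = k \<and>
           real (card (sym_diff F (\<Union>P)))
             \<le> C\<^sub>0 * (sqrt (2 * real k * (\<bar>\<epsilon>\<bar> + \<delta>)) + real k / real n) * real (card F)) \<and>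
        (\<epsilon> = 0 \<and> \<delta> = 0 \<longrightarrow>
           (\<exists>P \<subseteq> one_cosets n. card P = k \<and> pairwise disjnt P \<and> F = \<Union>P)))"
\<comment> \<open>The constant 11000 comes from \<open>stability\<close>, and c = 1 ensures its
  requirement that \<open>\<bar>\<epsilon>\<bar> + \<delta>\<close> be at most
  \<open>2 * real k\<close>.\<close>
proof (rule exI[of _ 11000], rule exI[of _ 1], intro conjI)
  show "(0 :: real) < 11000" "(0 :: real) < 1" by simp_all
  show "\<exists>N :: nat. \<forall>n \<ge> N. \<forall>(k :: nat) (\<epsilon> :: real) (\<delta> :: real) (F :: (nat \<Rightarrow> nat) set).
        real k \<le> (real n - 1) / 2 \<longrightarrow>
        \<epsilon> \<in> {-1/2 <.. 1/2} \<longrightarrow> \<delta> \<ge> 0 \<longrightarrow> max \<bar>\<epsilon>\<bar> \<delta> \<le> 1 * real k \<longrightarrow>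
        F \<subseteq> Sym n \<longrightarrow> real (card F) = (real k + \<epsilon>) * fact (n - 1) \<longrightarrow>
        real (total_intersection n F)
          \<ge> real (total_intersection n (extremal_family n (card F))) - \<delta> * (fact (n - 1))\<^sup>2 \<longrightarrow>
        (\<exists>P \<subseteq> one_cosets n. card P = k \<and>
           real (card (sym_diff F (\<Union>P)))
             \<le> 11000 * (sqrt (2 * real k * (\<bar>\<epsilon>\<bar> + \<delta>)) + real k / real n) * real (card F)) \<and>
        (\<epsilon> = 0 \<and> \<delta> = 0 \<longrightarrow>
           (\<exists>P \<subseteq> one_cosets n. card P = k \<and> pairwise disjnt P \<and> F = \<Union>P))"
  proof (rule exI[of _ 5], intro allI impI)
    fix n k :: nat and \<epsilon> \<delta> :: real and F :: "(nat \<Rightarrow> nat) set"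
    assume n: "5 \<le> n" and k: "real k \<le> (real n - 1) / 2" and \<epsilon>: "\<epsilon> \<in> {-1/2 <.. 1/2}" and \<delta>: "\<delta> \<ge> 0"
      and max: "max \<bar>\<epsilon>\<bar> \<delta> \<le> 1 * real k" and F: "F \<subseteq> Sym n"
      and card: "real (card F) = (real k + \<epsilon>) * fact (n - 1)"
      and I: "real (total_intersection n F)
          \<ge> real (total_intersection n (extremal_family n (card F))) - \<delta> * (fact (n - 1))\<^sup>2"
    interpret permutation_family n F by (rule permutation_family.intro[OF n F])
    show "(\<exists>P \<subseteq> one_cosets n. card P = k \<and>
           real (card (sym_diff F (\<Union>P)))
             \<le> 11000 * (sqrt (2 * real k * (\<bar>\<epsilon>\<bar> + \<delta>)) + real k / real n) * real (card F)) \<and>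
        (\<epsilon> = 0 \<and> \<delta> = 0 \<longrightarrow>
           (\<exists>P \<subseteq> one_cosets n. card P = k \<and> pairwise disjnt P \<and> F = \<Union>P))"
    proof (cases "k = 0")
      case True
      hence "\<epsilon> = 0" using max by simp
      hence "F = {}" using card True by simp
      thus ?thesis using True by (auto intro!: exI[of _ "{}"])
    next
      case False
      have eps: "-1/2 < \<epsilon>" "\<epsilon> \<le> 1/2" using \<epsilon> by auto
      have \<kappa>: "\<kappa> = real k + \<epsilon>" using card M_pos by (simp add: \<kappa>_def M_def)
      have k1: "1 \<le> k" using False by simp
      have "\<kappa> > 0" using \<kappa> k1 eps by simp
      hence pos: "card F > 0" by (cases "card F = 0") (simp_all add: \<kappa>_def card_gt_0_iff)
      \<comment> \<open>\<open>F\<close> is not all of \<open>Sym n\<close>, which leaves room for a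
        further coset in the competitor.\<close>
      have "\<kappa> < n" using \<kappa> eps k n by (simp add: field_simps)
      hence "real (card F) < fact n" using M_pos by (simp add: \<kappa>_def fact_n field_simps)
      hence lt: "card F < fact n" by (metis of_nat_fact of_nat_less_iff)
      have \<rho>: "\<rho> \<le> \<bar>\<epsilon>\<bar> + \<delta>"
        using I by (intro \<rho>_le[OF pos lt \<kappa> eps \<delta>]) (simp add: M_def)
      have b: "\<bar>\<epsilon>\<bar> \<le> 1/2" "\<bar>\<epsilon>\<bar> \<le> \<bar>\<epsilon>\<bar> + \<delta>" "\<bar>\<epsilon>\<bar> + \<delta> \<le> 2 * real k"
        using eps \<delta> max by auto
      from stability[OF \<kappa> k1 b(1) k \<rho> b(2,3)]
      obtain P where "P \<subseteq> one_cosets n" "card P = k" "real (card (sym_diff F (\<Union>P)))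
             \<le> 11000 * (sqrt (2 * real k * (\<bar>\<epsilon>\<bar> + \<delta>)) + real k / real n) * real (card F)" .
      moreover have "\<exists>P \<subseteq> one_cosets n. card P = k \<and> pairwise disjnt P \<and> F = \<Union>P"
        if "\<epsilon> = 0 \<and> \<delta> = 0"
      proof -
        have "\<rho> = 0" using \<rho> \<rho>_nonneg that by simp
        then obtain P where P: "P \<subseteq> one_cosets n" "pairwise disjnt P" "F = \<Union>P"
          by (rule union_of_disjoint_cosets)
        \<comment> \<open>The classification leaves the number of cosets open; comparing
          cardinalities gives \<open>k\<close>.\<close>
        have "real (card P) * M = real k * M"
          using card_Union_disjoint_cosets[OF P(1,2)] card that P(3) by (simp add: M_def)
        hence "card P = k" using M_pos by simp
        thus ?thesis using P by blast
      qed
      ultimately show ?thesis by blast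
    qed
  qed
qed

end
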